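(* Let $m$ and $k$ be positive integers, let $G$ be a graph and let $X\subseteq V(G)$. Then for every factor $M$ of $G$ with maximum degree $\Delta(M)\le m$, $G$ has an $m$-tree-connected factor $H$ containing $M$ such that for each $v\in X$, $$d_H(v)\le \begin{cases} \big\lceil \frac{m}{k}(d_G(v)-2m)\big \rceil+2m, &\text{if $G$ is $k$-edge-connected and $k\ge 2m$};\\ \big\lceil \frac{m}{k}(d_G(v)-m)\big\rceil+m, &\text{if $G$ is $k$-tree-connected and $k\ge m$};\\ \big\lceil \frac{m}{k}d_G(v)\big \rceil+m, &\text{if $G$ is $k$-edge-connected, $k\ge 2m$, and $X$ is independent};\\ \big\lceil \frac{m}{k}d_G(v)\big\rceil, &\text{if $G$ is $k$-tree-connected, $k\ge m$, and $X$ is independent}. \end{cases}$$ Furthermore, for an arbitrary given vertex $u\in X$, $H$ can be chosen so that in addition the upper bound at $u$ is reduced to $d_H(u)\le\lfloor \frac{m}{k}d_G(u)\rfloor$.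
   Context: Graphs are finite, loopless, and may have multiple edges. A factor of $G$ is a spanning subgraph. A graph is $m$-tree-connected (resp. $k$-tree-connected) if it contains $m$ (resp. $k$) pairwise edge-disjoint spanning trees. A set of vertices is independent if no edge joins two of its vertices. $d_G(v)$ denotes the degree of $v$ in $G$. *)

theory Defs
  imports Complex_Main
begin

record ('v, 'e) mgraph =
  verts :: "'v set"
  edges :: "'e set"
  ends :: "'e \<Rightarrow> 'v set"

text \<open>
  A finite loopless multigraph: parallel edges are distinct elements of the edge set with the
  same set of two ends. The values of the function \<open>ends\<close> outside the edge set are irrelevant.
\<close>

definition multigraph :: "('v, 'e) mgraph \<Rightarrow> bool" where
  "multigraph G \<longleftrightarrow>
     finite (verts G) \<and> verts G \<noteq> {} \<and> finite (edges G) \<and>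
     (\<forall>e\<in>edges G. ends G e \<subseteq> verts G \<and> card (ends G e) = 2)"

definition degree :: "('v, 'e) mgraph \<Rightarrow> 'v \<Rightarrow> nat" where
  "degree G v = card {e \<in> edges G. v \<in> ends G e}"

definition max_degree :: "('v, 'e) mgraph \<Rightarrow> nat" where
  "max_degree G = Max (degree G ` verts G)"

definition subgraph :: "('v, 'e) mgraph \<Rightarrow> ('v, 'e) mgraph \<Rightarrow> bool" where
  "subgraph H G \<longleftrightarrow>
     multigraph H \<and> verts H \<subseteq> verts G \<and> edges H \<subseteq> edges G \<and>
     (\<forall>e\<in>edges H. ends H e = ends G e)"

definition is_factor :: "('v, 'e) mgraph \<Rightarrow> ('v, 'e) mgraph \<Rightarrow> bool" where
  "is_factor H G \<longleftrightarrow> subgraph H G \<and> verts H = verts G"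

definition adjacency :: "('v, 'e) mgraph \<Rightarrow> ('v \<times> 'v) set" where
  "adjacency G = {(x, y). \<exists>e\<in>edges G. ends G e = {x, y}}"

definition connected_graph :: "('v, 'e) mgraph \<Rightarrow> bool" where
  "connected_graph G \<longleftrightarrow> (\<forall>x\<in>verts G. \<forall>y\<in>verts G. (x, y) \<in> (adjacency G)\<^sup>*)"

text \<open>
  The cycle visits the vertices \<open>vs\<close> and traverses the edges \<open>es\<close> in this cyclic order.
  Distinctness of the edges only matters for length two, where it requires two parallel edges.
\<close>

definition is_cycle :: "('v, 'e) mgraph \<Rightarrow> 'v list \<Rightarrow> 'e list \<Rightarrow> bool" where
  "is_cycle G vs es \<longleftrightarrow>
     length vs \<ge> 2 \<and> length es = length vs \<and> distinct vs \<and> distinct es \<and>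
     set es \<subseteq> edges G \<and>
     (\<forall>i<length vs. ends G (es ! i) = {vs ! i, vs ! (Suc i mod length vs)})"

definition is_tree :: "('v, 'e) mgraph \<Rightarrow> bool" where
  "is_tree G \<longleftrightarrow> multigraph G \<and> connected_graph G \<and> (\<nexists>vs es. is_cycle G vs es)"

definition spanning_tree :: "('v, 'e) mgraph \<Rightarrow> ('v, 'e) mgraph \<Rightarrow> bool" where
  "spanning_tree T G \<longleftrightarrow> is_factor T G \<and> is_tree T"

text \<open>
  The trees form an indexed family, so a one-vertex graph is \<open>k\<close>-tree-connected for every \<open>k\<close>
  (the edgeless tree may be repeated). Likewise it is \<open>k\<close>-edge-connected for every \<open>k\<close>.
\<close>

definition tree_connected :: "nat \<Rightarrow> ('v, 'e) mgraph \<Rightarrow> bool" where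
  "tree_connected k G \<longleftrightarrow>
     (\<exists>T :: nat \<Rightarrow> ('v, 'e) mgraph.
        (\<forall>i<k. spanning_tree (T i) G) \<and>
        (\<forall>i<k. \<forall>j<k. i \<noteq> j \<longrightarrow> edges (T i) \<inter> edges (T j) = {}))"

definition delete_edges :: "('v, 'e) mgraph \<Rightarrow> 'e set \<Rightarrow> ('v, 'e) mgraph" where
  "delete_edges G F = G\<lparr>edges := edges G - F\<rparr>"

definition edge_connected :: "nat \<Rightarrow> ('v, 'e) mgraph \<Rightarrow> bool" where
  "edge_connected k G \<longleftrightarrow>
     (\<forall>F. F \<subseteq> edges G \<and> card F < k \<longrightarrow> connected_graph (delete_edges G F))"

definition independent_set :: "('v, 'e) mgraph \<Rightarrow> 'v set \<Rightarrow> bool" where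
  "independent_set G X \<longleftrightarrow> (\<forall>x\<in>X. \<forall>y\<in>X. (x, y) \<notin> adjacency G)"

text \<open>
  Several of the four conditions can hold at once. Then one of the applicable bounds is the
  smallest, so requiring all of them of a single \<open>H\<close> amounts to four separate claims. The
  subtractions are taken in the reals, since \<open>degree G v\<close> is zero in a one-vertex graph.
\<close>

definition degree_bounds ::
  "nat \<Rightarrow> nat \<Rightarrow> ('v, 'e) mgraph \<Rightarrow> 'v set \<Rightarrow> ('v, 'e) mgraph \<Rightarrow> 'v \<Rightarrow> bool" where
  "degree_bounds m k G X H v \<longleftrightarrow>
     (edge_connected k G \<and> k \<ge> 2 * m \<longrightarrow>
        int (degree H v) \<le>
          \<lceil>real m / real k * (real (degree G v) - 2 * real m)\<rceil> + 2 * int m) \<and>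
     (tree_connected k G \<and> k \<ge> m \<longrightarrow>
        int (degree H v) \<le>
          \<lceil>real m / real k * (real (degree G v) - real m)\<rceil> + int m) \<and>
     (edge_connected k G \<and> k \<ge> 2 * m \<and> independent_set G X \<longrightarrow>
        int (degree H v) \<le> \<lceil>real m / real k * real (degree G v)\<rceil> + int m) \<and>
     (tree_connected k G \<and> k \<ge> m \<and> independent_set G X \<longrightarrow>
        int (degree H v) \<le> \<lceil>real m / real k * real (degree G v)\<rceil>)"

end

theory Submission
  imports Defs
begin

text \<open>
  An edge set \<open>F\<close> is \<open>m\<close>-sparse if every nonempty vertex set \<open>Q\<close> spans at most \<open>m * (card Q - 1)\<close>
  of its edges, and tight on \<open>Q\<close> in case of equality. By the arboricity theorem of Nash-Williams, the
  sparse sets that are tight on all vertices are exactly the unions of \<open>m\<close> disjoint spanning trees.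
  Since \<open>M\<close> has maximum degree at most \<open>m\<close>, it is sparse, hence contained in such a basis.

  Among the bases \<open>F\<close> containing \<open>M\<close>, choose one of least total excess over the desired degree bounds
  \<open>b\<close>. If the excess is positive, exchange arguments yield a nonempty \<open>S \<subseteq> X\<close> with
  \<open>sum b S < sum (deg F) S\<close> such that all edges of \<open>G - S\<close> between different maximal tight sets of
  \<open>G - S\<close> lie in \<open>F\<close>. Counting the edges of \<open>F\<close> outside these tight sets turns this into an upper
  bound on \<open>sum b S\<close> that contradicts \<open>b v = m/k * d v + c\<close> (rounded), because \<open>k\<close> spanning trees,
  or \<open>k\<close> edges in every cut, force many edges at \<open>S\<close> and between the parts. The constant \<open>c\<close> pays
  for the edges of \<open>F\<close> inside \<open>S\<close>: these are counted twice in the degree sum, but sparseness leaves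
  at most \<open>m * (card S - 1)\<close> of them.
\<close>

section \<open>Connectivity, forests and edge counts in a fixed multigraph\<close>

locale multi =
  fixes V :: "'v set" and E :: "'e set" and \<delta> :: "'e \<Rightarrow> 'v set"
  assumes finV: "finite V" and neV: "V \<noteq> {}" and finE: "finite E"
    and ends_sub: "e \<in> E \<Longrightarrow> \<delta> e \<subseteq> V" and ends_card: "e \<in> E \<Longrightarrow> card (\<delta> e) = 2"
begin

definition adj :: "'e set \<Rightarrow> ('v \<times> 'v) set" where
  "adj F = {(x, y). \<exists>e\<in>F. \<delta> e = {x, y}}"

definition conn :: "'e set \<Rightarrow> ('v \<times> 'v) set" where
  "conn F = (adj F)\<^sup>*"

text \<open>Acyclicity in bridge form: no edge is bypassed by the others. Exchanges can then be
  handled through \<open>conn\<close> alone; \<open>forest_no_cycle\<close> translates back to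
  cycles.\<close>

definition forest :: "'e set \<Rightarrow> bool" where
  "forest F \<longleftrightarrow> (\<forall>e\<in>F. \<forall>x y. \<delta> e = {x, y} \<longrightarrow> (x, y) \<notin> conn (F - {e}))"

definition ind :: "'e set \<Rightarrow> 'v set \<Rightarrow> 'e set" where
  "ind F Q = {e \<in> F. \<delta> e \<subseteq> Q}"

definition deg :: "'e set \<Rightarrow> 'v \<Rightarrow> nat" where
  "deg F v = card {e \<in> F. v \<in> \<delta> e}"

text \<open>Independence in the union of \<open>m\<close> graphic matroids. Keeping \<open>m\<close>
  on the left avoids truncated subtraction.\<close>

definition sparse :: "nat \<Rightarrow> 'e set \<Rightarrow> bool" where
  "sparse m F \<longleftrightarrow> F \<subseteq> E \<and> (\<forall>Q. Q \<subseteq> V \<and> Q \<noteq> {} \<longrightarrow> card (ind F Q) + m \<le> m * card Q)"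

lemma ends_obtain:
  assumes "e \<in> E"
  obtains x y where "\<delta> e = {x, y}" "x \<noteq> y" "x \<in> V" "y \<in> V"
  using ends_sub[OF assms] ends_card[OF assms] by (auto simp: card_2_iff)

lemma ends_nonempty: "e \<in> E \<Longrightarrow> \<delta> e \<noteq> {}"
  using ends_card by fastforce

lemma finite_edges: "F \<subseteq> E \<Longrightarrow> finite F"
  using finE finite_subset by blast

lemma finite_ind: "F \<subseteq> E \<Longrightarrow> finite (ind F Q)"
  unfolding ind_def by (simp add: finite_edges)

lemma adj_sym: "(x, y) \<in> adj F \<Longrightarrow> (y, x) \<in> adj F"
  unfolding adj_def by (auto simp: insert_commute)

lemma conn_refl [simp]: "(x, x) \<in> conn F"
  by (simp add: conn_def)

lemma conn_sym: "(x, y) \<in> conn F \<Longrightarrow> (y, x) \<in> conn F"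
  unfolding conn_def by (meson adj_sym symI sym_rtrancl symD)

lemma conn_trans: "(x, y) \<in> conn F \<Longrightarrow> (y, z) \<in> conn F \<Longrightarrow> (x, z) \<in> conn F"
  unfolding conn_def by simp

lemma conn_edge: "e \<in> F \<Longrightarrow> \<delta> e = {x, y} \<Longrightarrow> (x, y) \<in> conn F"
  unfolding conn_def adj_def by blast

lemma conn_subI:
  assumes "\<And>e x y. e \<in> F \<Longrightarrow> \<delta> e = {x, y} \<Longrightarrow> (x, y) \<in> conn F'"
  shows "conn F \<subseteq> conn F'"
proof -
  have "adj F \<subseteq> conn F'"
    using assms unfolding adj_def by blast
  then show ?thesis
    unfolding conn_def by (metis rtrancl_subset_rtrancl)
qed

lemma conn_mono: "F \<subseteq> F' \<Longrightarrow> conn F \<subseteq> conn F'"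
  by (rule conn_subI) (auto intro: conn_edge)

lemma conn_insert:
  assumes "\<delta> e = {a, b}"
  shows "(x, y) \<in> conn (insert e F) \<longleftrightarrow> (x, y) \<in> conn F \<or>
    (x, a) \<in> conn F \<and> (b, y) \<in> conn F \<or> (x, b) \<in> conn F \<and> (a, y) \<in> conn F"
    (is "?l \<longleftrightarrow> ?r")
proof
  have "adj (insert e F) = insert (a, b) (insert (b, a) (adj F))"
    using assms unfolding adj_def by (auto simp: doubleton_eq_iff)
  then show "?l \<Longrightarrow> ?r"
    unfolding conn_def by (auto simp: rtrancl_insert) (meson rtrancl_trans)+
next
  have sub: "conn F \<subseteq> conn (insert e F)" by (intro conn_mono) blast
  have ab: "(a, b) \<in> conn (insert e F)" using conn_edge assms by blast
  show "?r \<Longrightarrow> ?l"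
    using sub conn_trans[OF conn_trans[OF _ ab]] conn_trans[OF conn_trans[OF _ conn_sym[OF ab]]]
    by blast
qed

lemma conn_closed:
  assumes "(x, y) \<in> conn F" "x \<in> Q" "\<And>e. e \<in> F \<Longrightarrow> \<delta> e \<inter> Q \<noteq> {} \<Longrightarrow> \<delta> e \<subseteq> Q"
  shows "y \<in> Q"
  using assms(1,2) unfolding conn_def
proof (induction rule: rtrancl_induct)
  case (step y z)
  then show ?case using assms(3) unfolding adj_def by blast
qed

lemma forest_subset: "forest F \<Longrightarrow> F' \<subseteq> F \<Longrightarrow> forest F'"
  unfolding forest_def using conn_mono[of "F' - {_}" "F - {_}"] by (meson Diff_mono order_refl subsetD)

text \<open>If an old edge \<open>g\<close> stopped being a bridge, its bypass would have to use
  \<open>e\<close>; then \<open>g\<close> and the two halves of that bypass would join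
  \<open>x\<close> to \<open>y\<close> inside \<open>F\<close>.\<close>

lemma forest_insert:
  assumes "forest F" "\<delta> e = {x, y}" "(x, y) \<notin> conn F"
  shows "forest (insert e F)"
  unfolding forest_def
proof (intro ballI allI impI notI)
  fix g a b
  assume g: "g \<in> insert e F" "\<delta> g = {a, b}" "(a, b) \<in> conn (insert e F - {g})"
  have nin: "e \<notin> F" using assms(2,3) conn_edge by blast
  show False
  proof (cases "g = e")
    case True
    then show False
      using g assms nin conn_sym by (auto simp: doubleton_eq_iff)
  next
    case False
    let ?F = "F - {g}"
    have gF: "g \<in> F" using g False by simp
    have nab: "(a, b) \<notin> conn ?F" using assms(1) gF g(2) unfolding forest_def by blast
    have "insert e F - {g} = insert e ?F" using False by blast
    with g(3) nab have "(a, x) \<in> conn ?F \<and> (y, b) \<in> conn ?F \<or> (a, y) \<in> conn ?F \<and> (x, b) \<in> conn ?F"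
      using conn_insert[OF assms(2)] by metis
    then have "(a, x) \<in> conn F \<and> (y, b) \<in> conn F \<or> (a, y) \<in> conn F \<and> (x, b) \<in> conn F"
      using conn_mono[of ?F F] by blast
    moreover have "(a, b) \<in> conn F" using conn_edge gF g(2) by blast
    ultimately show False
      using assms(3) conn_sym conn_trans by meson
  qed
qed

text \<open>A connecting set \<open>D\<close> with fewest edges is the path from \<open>x\<close> to
  \<open>y\<close>. Were \<open>x\<close> and \<open>y\<close> still joined without some
  \<open>f\<close> of \<open>D\<close>, the rest of \<open>D\<close> and that second connection
  would bypass \<open>f\<close>.\<close>

lemma forest_path:
  assumes "forest F" "finite F" "\<And>e. e \<in> F \<Longrightarrow> e \<in> E" "(x, y) \<in> conn F"
  obtains D where "D \<subseteq> F" "(x, y) \<in> conn D" "\<And>f. f \<in> D \<Longrightarrow> (x, y) \<notin> conn (F - {f})"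
proof -
  let ?P = "\<lambda>D. D \<subseteq> F \<and> (x, y) \<in> conn D"
  obtain D where D: "?P D" "\<And>D'. ?P D' \<Longrightarrow> card D \<le> card D'"
    using ex_has_least_nat[of ?P F card] assms(4) by auto
  have "(x, y) \<notin> conn (F - {f})" if f: "f \<in> D" for f
  proof
    assume c: "(x, y) \<in> conn (F - {f})"
    have "finite D" using D(1) assms(2) finite_subset by blast
    then have "card (D - {f}) < card D" using f by (rule card_Diff1_less)
    then have n: "(x, y) \<notin> conn (D - {f})"
      using D(1) D(2)[of "D - {f}"] by (meson Diff_subset leD order_trans)
    have "f \<in> E" using assms(3) D(1) f by blast
    then obtain a b where ab: "\<delta> f = {a, b}" by (rule ends_obtain)
    have "insert f (D - {f}) = D" using f by blast
    then have "(x, a) \<in> conn (D - {f}) \<and> (b, y) \<in> conn (D - {f}) \<or>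
        (x, b) \<in> conn (D - {f}) \<and> (a, y) \<in> conn (D - {f})"
      using conn_insert[OF ab, of x y "D - {f}"] D(1) n by simp
    moreover have "conn (D - {f}) \<subseteq> conn (F - {f})" using D(1) by (intro conn_mono) blast
    ultimately have "(a, b) \<in> conn (F - {f})" using c conn_sym conn_trans by (meson subsetD)
    then show False using assms(1) f D(1) ab unfolding forest_def by blast
  qed
  with D(1) that show ?thesis by blast
qed

text \<open>A labelling \<open>p\<close> stands for the partition into its fibres, so merging or
  refining classes is mere relabelling.\<close>

definition crossing :: "'e set \<Rightarrow> ('v \<Rightarrow> 'l) \<Rightarrow> 'e set" where
  "crossing F p = {e \<in> F. \<exists>x\<in>\<delta> e. \<exists>y\<in>\<delta> e. p x \<noteq> p y}"

text \<open>Contracting the classes of \<open>p\<close> leaves a connected graph. The induction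
  merges two classes joined by a crossing edge, which loses one class and at least that
  edge.\<close>

lemma crossing_bound:
  assumes "F \<subseteq> E" "finite U" "U \<noteq> {}" "\<And>e. e \<in> F \<Longrightarrow> \<delta> e \<subseteq> U"
    and "\<And>x y. x \<in> U \<Longrightarrow> y \<in> U \<Longrightarrow> (x, y) \<in> conn F"
  shows "card (p ` U) \<le> card (crossing F p) + 1"
proof (induction "card (p ` U)" arbitrary: p rule: less_induct)
  case less
  show ?case
  proof (cases "card (p ` U) \<le> 1")
    case False
    obtain x where x: "x \<in> U" using assms(3) by blast
    have "\<exists>y\<in>U. p y \<noteq> p x"
    proof (rule ccontr)
      assume "\<not> ?thesis"
      then have "p ` U \<subseteq> {p x}" by blast
      then have "card (p ` U) \<le> card {p x}" by (intro card_mono) simp_all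
      with False show False by simp
    qed
    then obtain y where y: "y \<in> U" "p y \<noteq> p x" by blast
    have "\<exists>e\<in>F. \<exists>a\<in>\<delta> e. \<exists>c\<in>\<delta> e. p a = p x \<and> p c \<noteq> p x"
      using conn_closed[OF assms(5)[OF x y(1)], of "{z. p z = p x}"] y by blast
    then obtain e a c where e: "e \<in> F" "a \<in> \<delta> e" "c \<in> \<delta> e" "p a = p x" "p c \<noteq> p x" by blast
    have "card (\<delta> e) = 2" using e(1) assms(1) ends_card by blast
    then have ac: "\<delta> e = {a, c}" using e by (auto simp: card_2_iff)
    have cU: "c \<in> U" using assms(4) e by blast
    define q where "q v = (if p v = p c then p x else p v)" for v
    have qU: "q ` U = p ` U - {p c}"
      using x e(5) by (auto simp: q_def image_iff)
    have lt: "card (q ` U) + 1 = card (p ` U)"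
      unfolding qU using cU assms(2) card.remove[of "p ` U" "p c"] by simp
    have eq: "q a = q c" using e(4) by (simp add: q_def)
    then have "e \<notin> crossing F q" by (simp add: crossing_def ac)
    moreover have "crossing F q \<subseteq> crossing F p"
    proof
      fix g assume "g \<in> crossing F q"
      then obtain v w where g: "g \<in> F" "v \<in> \<delta> g" "w \<in> \<delta> g" "q v \<noteq> q w"
        unfolding crossing_def by blast
      then have "p v \<noteq> p w" unfolding q_def by metis
      then show "g \<in> crossing F p" using g unfolding crossing_def by blast
    qed
    ultimately have "crossing F q \<subseteq> crossing F p - {e}" by blast
    moreover have fin: "finite (crossing F p)"
      using finite_edges[OF assms(1)] by (simp add: crossing_def)
    moreover have "p a \<noteq> p c" using e(4,5) by simp
    then have "e \<in> crossing F p" using e(1-3) unfolding crossing_def by blast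
    ultimately have "card (crossing F q) < card (crossing F p)"
      by (meson card_Diff1_less card_mono finite_Diff le_less_trans)
    with less[of q] lt show ?thesis by simp
  qed simp
qed

lemma connected_card:
  assumes "F \<subseteq> E" "finite U" "U \<noteq> {}" "\<And>e. e \<in> F \<Longrightarrow> \<delta> e \<subseteq> U"
    and "\<And>x y. x \<in> U \<Longrightarrow> y \<in> U \<Longrightarrow> (x, y) \<in> conn F"
  shows "card U \<le> card F + 1"
proof -
  have "card U \<le> card (crossing F (\<lambda>v. v)) + 1"
    using crossing_bound[OF assms, of "\<lambda>v. v"] by simp
  moreover have "card (crossing F (\<lambda>v. v)) \<le> card F"
    using assms(1) finite_edges by (intro card_mono) (auto simp: crossing_def)
  ultimately show ?thesis by simp
qed

lemma conn_ind:
  assumes "(x, y) \<in> conn F" "x \<in> U" "\<And>e. e \<in> F \<Longrightarrow> \<delta> e \<inter> U \<noteq> {} \<Longrightarrow> \<delta> e \<subseteq> U"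
    and "F \<subseteq> E"
  shows "(x, y) \<in> conn (ind F U)"
proof -
  have "y \<in> {z \<in> U. (x, z) \<in> conn (ind F U)}"
  proof (rule conn_closed[OF assms(1)])
    fix e assume e: "e \<in> F" "\<delta> e \<inter> {z \<in> U. (x, z) \<in> conn (ind F U)} \<noteq> {}"
    then obtain z where z: "z \<in> \<delta> e" "z \<in> U" "(x, z) \<in> conn (ind F U)" by blast
    have eU: "e \<in> ind F U" using e z assms(3) unfolding ind_def by blast
    have "(z, w) \<in> conn (ind F U)" if "w \<in> \<delta> e" for w
    proof -
      have "e \<in> E" using assms(4) e(1) by blast
      then obtain a b where "\<delta> e = {a, b}" by (rule ends_obtain)
      then show ?thesis
        using conn_edge[OF eU] conn_sym conn_refl z that by (metis insert_iff singletonD)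
    qed
    then show "\<delta> e \<subseteq> {z \<in> U. (x, z) \<in> conn (ind F U)}"
      using z eU conn_trans unfolding ind_def by blast
  qed (use assms(2) in simp)
  then show ?thesis by blast
qed

text \<open>Each new edge of a forest joins two different components. The map \<open>?g\<close>
  sends the old components onto the new ones and identifies those of the two ends, so their number
  drops.\<close>

lemma forest_card:
  assumes "F \<subseteq> E" "forest F"
  shows "card F + card ((\<lambda>v. conn F `` {v}) ` V) \<le> card V"
proof -
  have "finite F" using assms(1) finite_edges by blast
  then show ?thesis using assms
  proof (induction F rule: finite_induct)
    case empty
    show ?case by (simp add: card_image_le finV)
  next
    case (insert e F)
    have "e \<in> E" using insert.prems(1) by simp
    then obtain a b where ab: "\<delta> e = {a, b}" "a \<in> V" "b \<in> V" by (rule ends_obtain)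
    let ?c = "\<lambda>F v. conn F `` {v}" and ?g = "\<lambda>C. conn (insert e F) `` C"
    have sub: "conn F \<subseteq> conn (insert e F)" by (intro conn_mono) blast
    have eq: "?g (?c F v) = ?c (insert e F) v" for v
      using sub conn_trans conn_refl by fastforce
    have "(a, b) \<notin> conn F"
      using insert.prems(2) insert.hyps(2) ab(1) unfolding forest_def by fastforce
    then have ne: "?c F a \<noteq> ?c F b" using conn_sym by fastforce
    have "(a, b) \<in> conn (insert e F)" using conn_edge ab(1) by blast
    then have "?c (insert e F) a = ?c (insert e F) b"
      using conn_trans conn_sym by blast
    then have "?g (?c F a) = ?g (?c F b)" by (simp only: eq)
    then have "\<not> inj_on ?g (?c F ` V)"
      using ne ab(2,3) inj_onD[of ?g "?c F ` V" "?c F a" "?c F b"] by blast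
    then have "card (?g ` ?c F ` V) < card (?c F ` V)"
      using finV by (metis card_image_le eq_card_imp_inj_on finite_imageI le_neq_implies_less)
    moreover have "?g ` ?c F ` V = ?c (insert e F) ` V"
      unfolding image_image eq ..
    moreover have "card F + card (?c F ` V) \<le> card V"
      using insert.IH insert.prems forest_subset by blast
    ultimately show ?case using insert.hyps by simp
  qed
qed

lemma forest_card_le:
  assumes "F \<subseteq> E" "forest F"
  shows "card F + 1 \<le> card V"
proof -
  have "card ((\<lambda>v. conn F `` {v}) ` V) \<noteq> 0" using finV neV by simp
  then show ?thesis using forest_card[OF assms] by linarith
qed

lemma forest_spanning:
  assumes "F \<subseteq> E" "forest F" "card F + 1 = card V" "x \<in> V" "y \<in> V"
  shows "(x, y) \<in> conn F"
proof -
  let ?C = "(\<lambda>v. conn F `` {v}) ` V"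
  have "card ?C \<le> 1" using forest_card[OF assms(1,2)] assms(3) by simp
  moreover have "finite ?C" using finV by simp
  ultimately have "\<forall>A\<in>?C. \<forall>B\<in>?C. A = B"
    using card_le_Suc0_iff_eq[of ?C] by (simp only: One_nat_def)
  then have "conn F `` {x} = conn F `` {y}" using assms(4,5) by (meson imageI)
  then have "y \<in> conn F `` {x}" by simp
  then show ?thesis by simp
qed

subsection \<open>Packing forests\<close>

text \<open>
  Diestel's exchange argument: in a packing that covers as many edges as possible, every forest
  connects each component of the edges that some sequence of exchanges leaves uncovered. The vertex
  set of such a component then violates sparseness.
\<close>

definition packing :: "nat \<Rightarrow> 'e set \<Rightarrow> (nat \<Rightarrow> 'e set) \<Rightarrow> bool" where
  "packing m F T \<longleftrightarrow> (\<forall>i<m. T i \<subseteq> F \<and> forest (T i)) \<and>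
     (\<forall>i<m. \<forall>j<m. i \<noteq> j \<longrightarrow> T i \<inter> T j = {})"

lemma packingD:
  assumes "packing m F T" "i < m"
  shows packing_subset: "T i \<subseteq> F" and packing_forest: "forest (T i)"
    and packing_disjoint: "j < m \<Longrightarrow> i \<noteq> j \<Longrightarrow> T i \<inter> T j = {}"
  using assms unfolding packing_def by simp_all

abbreviation covered :: "nat \<Rightarrow> (nat \<Rightarrow> 'e set) \<Rightarrow> 'e set" where
  "covered m T \<equiv> \<Union>i<m. T i"

inductive reach :: "nat \<Rightarrow> 'e set \<Rightarrow> (nat \<Rightarrow> 'e set) \<Rightarrow> (nat \<Rightarrow> 'e set) \<Rightarrow> bool"
  for m F T0 where
  base: "reach m F T0 T0"
| step: "reach m F T0 T \<Longrightarrow> i < m \<Longrightarrow> e \<in> F - covered m T \<Longrightarrow> f \<in> T i \<Longrightarrow>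
    forest (insert e (T i - {f})) \<Longrightarrow> reach m F T0 (T(i := insert e (T i - {f})))"

lemma covered_subset: "packing m F T \<Longrightarrow> covered m T \<subseteq> F"
  using packing_subset by (intro UN_least) simp

lemma packing_exchange:
  assumes "packing m F T" "i < m" "e \<in> F - covered m T" "forest (insert e T')" "T' \<subseteq> T i"
  shows "packing m F (T(i := insert e T'))"
proof -
  let ?T = "T(i := insert e T')"
  have e: "e \<notin> T j" if "j < m" for j using assms(3) that by blast
  have "?T j \<subseteq> F \<and> forest (?T j)" if "j < m" for j
    using assms that unfolding packing_def by (cases "j = i") auto
  moreover have "?T j \<inter> ?T l = {}" if jl: "j < m" "l < m" "j \<noteq> l" for j l
  proof -
    have "T j \<inter> T l = {}" using assms(1) jl unfolding packing_def by blast
    then show ?thesis using e[OF jl(1)] e[OF jl(2)] assms(5) jl(3)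
      by (cases "j = i"; cases "l = i") auto
  qed
  ultimately show ?thesis unfolding packing_def by blast
qed

lemma covered_exchange:
  assumes "packing m F T" "i < m" "f \<in> T i" "e \<in> F - covered m T"
  shows "covered m (T(i := insert e (T i - {f}))) = insert e (covered m T - {f})"
proof -
  let ?T = "T(i := insert e (T i - {f}))"
  have f: "f \<notin> T j" if "j < m" "j \<noteq> i" for j
    using packing_disjoint[OF assms(1) that(1) assms(2) that(2)] assms(3) by blast
  have "e \<noteq> f" using assms(2-4) by blast
  show ?thesis
  proof (intro equalityI subsetI)
    fix g assume "g \<in> covered m ?T"
    then obtain j where j: "j < m" "g \<in> ?T j" by blast
    then show "g \<in> insert e (covered m T - {f})" using f[of j] by (cases "j = i") auto
  next
    fix g assume g: "g \<in> insert e (covered m T - {f})"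
    show "g \<in> covered m ?T"
    proof (cases "g = e")
      case True
      then show ?thesis using assms(2) by auto
    next
      case False
      then obtain j where "j < m" "g \<in> T j" "g \<noteq> f" using g by blast
      then have "g \<in> ?T j" by (cases "j = i") simp_all
      then show ?thesis using \<open>j < m\<close> by blast
    qed
  qed
qed

text \<open>A swap covers \<open>e\<close> and uncovers \<open>f\<close>, so the number of covered
  edges is invariant: every packing reached from a maximal one is again maximal.\<close>

lemma reach_packing:
  assumes "reach m F T0 T" "packing m F T0" "F \<subseteq> E"
  shows "packing m F T \<and> card (covered m T) = card (covered m T0)"
  using assms(1)
proof induction
  case base
  then show ?case using assms(2) by simp
next
  case (step T i e f)
  then have p: "packing m F T" by blast
  have "covered m T \<subseteq> F" using covered_subset[OF p] .
  then have fin: "finite (covered m T)" using assms(3) finite_edges by blast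
  moreover have f: "f \<in> covered m T" using step.hyps(2,4) by blast
  moreover have "e \<notin> covered m T" using step.hyps(3) by blast
  ultimately have "card (insert e (covered m T - {f})) = card (covered m T)"
    using card.remove[OF fin f] fin by (simp only: card_insert_disjoint finite_Diff) simp
  then show ?case
    using packing_exchange[OF p step.hyps(2,3,5)] covered_exchange[OF p step.hyps(2,4,3)] step.IH
    by (simp only: Diff_subset)
qed

definition uncovered :: "nat \<Rightarrow> 'e set \<Rightarrow> (nat \<Rightarrow> 'e set) \<Rightarrow> 'e set" where
  "uncovered m F T0 = {e \<in> F. \<exists>T. reach m F T0 T \<and> e \<notin> covered m T}"

context
  fixes m F T0
  assumes FE: "F \<subseteq> E" and T0: "packing m F T0"
    and maximal: "\<And>T. packing m F T \<Longrightarrow> card (covered m T) \<le> card (covered m T0)"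
begin

text \<open>By maximality, \<open>e\<close> cannot be added to the forest \<open>T i\<close>, so
  \<open>T i\<close> has a path between its ends. Every edge \<open>f\<close> of that path can be
  swapped out for \<open>e\<close>, which leaves \<open>f\<close> uncovered; hence the whole path
  lies in \<open>uncovered\<close>.\<close>

lemma uncovered_conn:
  assumes "reach m F T0 T" "e \<in> F - covered m T" "\<delta> e = {x, y}" "i < m"
  shows "(x, y) \<in> conn (T i \<inter> uncovered m F T0)"
proof -
  have p: "packing m F T" and card_eq: "card (covered m T) = card (covered m T0)"
    using reach_packing[OF assms(1) T0 FE] by auto
  have Ti: "T i \<subseteq> F" "forest (T i)" using packingD[OF p assms(4)] by blast+
  have fin: "finite (T i)" "\<And>g. g \<in> T i \<Longrightarrow> g \<in> E" using Ti FE finite_edges by blast+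
  have "(x, y) \<in> conn (T i)"
  proof (rule ccontr)
    assume "(x, y) \<notin> conn (T i)"
    then have P: "packing m F (T(i := insert e (T i)))"
      using packing_exchange[OF p assms(4,2)] forest_insert[OF Ti(2) assms(3)] by blast
    from maximal[OF P]
    have "card (covered m (T(i := insert e (T i)))) \<le> card (covered m T)" using card_eq by simp
    moreover have "insert e (covered m T) \<subseteq> covered m (T(i := insert e (T i)))"
      using assms(4) by auto
    moreover have fin: "finite (covered m T')" if "packing m F T'" for T'
      using covered_subset[OF that] finite_edges[OF FE] finite_subset by metis
    ultimately have "card (insert e (covered m T)) \<le> card (covered m T)"
      using card_mono fin[OF P] by (meson le_trans)
    then show False using fin[OF p] assms(2) by simp
  qed
  then obtain D where D: "D \<subseteq> T i" "(x, y) \<in> conn D" "\<And>f. f \<in> D \<Longrightarrow> (x, y) \<notin> conn (T i - {f})"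
    using forest_path[OF Ti(2) fin] by blast
  have "f \<in> uncovered m F T0" if f: "f \<in> D" for f
  proof -
    have fT: "f \<in> T i" using f D(1) by blast
    have "forest (insert e (T i - {f}))"
      using forest_insert[OF forest_subset[OF Ti(2)] assms(3) D(3)[OF f]] by blast
    then have "reach m F T0 (T(i := insert e (T i - {f})))"
      by (rule reach.step[OF assms(1,4,2) fT])
    moreover have "f \<notin> covered m (T(i := insert e (T i - {f})))"
      unfolding covered_exchange[OF p assms(4) fT assms(2)] using fT assms(2,4) by blast
    ultimately show ?thesis unfolding uncovered_def using fT Ti(1) by blast
  qed
  then have "D \<subseteq> T i \<inter> uncovered m F T0" using D(1) by blast
  then show ?thesis using conn_mono D(2) by blast
qed

text \<open>Undoing one swap: the only edge a forest can have gained is \<open>e\<close>, and by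
  \<open>uncovered_conn\<close> the old forest already joins its ends along edges of
  \<open>uncovered\<close>.\<close>

lemma reach_conn_uncovered:
  assumes "reach m F T0 T" "i < m"
  shows "conn (T i \<inter> uncovered m F T0) \<subseteq> conn (T0 i \<inter> uncovered m F T0)"
  using assms(1)
proof induction
  case (step T j e f)
  let ?U = "uncovered m F T0"
  have "conn ((T(j := insert e (T j - {f}))) i \<inter> ?U) \<subseteq> conn (T i \<inter> ?U)"
  proof (rule conn_subI)
    fix g x y
    assume g: "g \<in> (T(j := insert e (T j - {f}))) i \<inter> ?U" "\<delta> g = {x, y}"
    show "(x, y) \<in> conn (T i \<inter> ?U)"
    proof (cases "g \<in> T i")
      case True
      then show ?thesis using g conn_edge by blast
    next
      case False
      then have "g = e" using g(1) by (auto split: if_splits)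
      then show ?thesis using uncovered_conn[OF step(1,3)] g(2) assms(2) by blast
    qed
  qed
  then show ?case using step.IH by blast
qed simp

lemma maximal_packing_covers:
  assumes "sparse m F"
  shows "covered m T0 = F"
proof (rule ccontr)
  assume "\<not> ?thesis"
  moreover have "covered m T0 \<subseteq> F" using packing_subset[OF T0] by blast
  ultimately obtain e0 where e0: "e0 \<in> F" "e0 \<notin> covered m T0" by blast
  have "e0 \<in> E" using e0(1) FE by blast
  then obtain x0 y0 where xy: "\<delta> e0 = {x0, y0}" "x0 \<in> V" by (rule ends_obtain)
  let ?U = "uncovered m F T0"
  have UE: "?U \<subseteq> E" using FE unfolding uncovered_def by blast
  have e0U: "e0 \<in> ?U" using e0 reach.base unfolding uncovered_def by blast
  define W where "W = {z. (x0, z) \<in> conn ?U}"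
  have WV: "W \<subseteq> V"
  proof
    fix z assume "z \<in> W"
    then have "(x0, z) \<in> conn ?U" unfolding W_def by simp
    then show "z \<in> V" by (rule conn_closed) (use xy UE ends_sub in blast)+
  qed
  then have finW: "finite W" using finV finite_subset by blast
  have x0W: "x0 \<in> W" unfolding W_def by simp
  have closed: "\<delta> g \<subseteq> W" if "g \<in> ?U" "\<delta> g \<inter> W \<noteq> {}" for g
  proof -
    have "g \<in> E" using that(1) UE by blast
    then obtain a b where ab: "\<delta> g = {a, b}" by (rule ends_obtain)
    have "(a, b) \<in> conn ?U" using conn_edge that(1) ab by blast
    then show ?thesis
      using that(2) conn_trans conn_sym unfolding ab W_def by blast
  qed
  have "e0 \<in> ind F W"
    using e0(1) closed[OF e0U] x0W xy(1) unfolding ind_def by blast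
  have big: "card W \<le> card (ind (T0 i) W) + 1" if i: "i < m" for i
  proof -
    let ?D = "T0 i \<inter> ?U"
    have DE: "?D \<subseteq> E" using UE by blast
    have TE: "T0 i \<subseteq> E" using packing_subset[OF T0 i] FE by blast
    \<comment> \<open>An edge of \<open>uncovered\<close> is missed by some reached packing, whose
      forest \<open>i\<close> joins its ends; the connection is then carried back to
      \<open>T0 i\<close>.\<close>
    have "conn ?U \<subseteq> conn ?D"
    proof (rule conn_subI)
      fix e x y assume e: "e \<in> ?U" "\<delta> e = {x, y}"
      then obtain T where T: "reach m F T0 T" "e \<in> F - covered m T"
        unfolding uncovered_def by blast
      then show "(x, y) \<in> conn ?D"
        using uncovered_conn[OF T e(2) i] reach_conn_uncovered[OF T(1) i] by blast
    qed
    then have x0z: "(x0, z) \<in> conn (ind ?D W)" if "z \<in> W" for z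
      using that conn_ind[of x0 z ?D W] x0W closed DE unfolding W_def by blast
    have "card W \<le> card (ind ?D W) + 1"
    proof (rule connected_card)
      show "(x, y) \<in> conn (ind ?D W)" if "x \<in> W" "y \<in> W" for x y
        using conn_trans[OF conn_sym[OF x0z] x0z] that by blast
    qed (use DE finW x0W in \<open>auto simp: ind_def\<close>)
    also have "card (ind ?D W) \<le> card (ind (T0 i) W)"
      using finite_ind[OF TE] by (intro card_mono) (auto simp: ind_def)
    finally show ?thesis by simp
  qed
  have "m * card W = (\<Sum>i<m. card W)" by simp
  also have "\<dots> \<le> (\<Sum>i<m. card (ind (T0 i) W) + 1)" using big by (intro sum_mono) simp
  also have "\<dots> = (\<Sum>i<m. card (ind (T0 i) W)) + m" by (simp only: sum.distrib) simp
  also have "(\<Sum>i<m. card (ind (T0 i) W)) = card (\<Union>i<m. ind (T0 i) W)"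
  proof (rule card_UN_disjoint[symmetric])
    show "\<forall>i\<in>{..<m}. finite (ind (T0 i) W)"
      using packing_subset[OF T0] FE by (meson finite_ind lessThan_iff order_trans)
    show "\<forall>i\<in>{..<m}. \<forall>j\<in>{..<m}. i \<noteq> j \<longrightarrow> ind (T0 i) W \<inter> ind (T0 j) W = {}"
    proof (intro ballI impI)
      fix i j assume "i \<in> {..<m}" "j \<in> {..<m}" "i \<noteq> j"
      then have "T0 i \<inter> T0 j = {}" using packing_disjoint[OF T0] by simp
      then show "ind (T0 i) W \<inter> ind (T0 j) W = {}" unfolding ind_def by blast
    qed
  qed simp
  \<comment> \<open>The forests of \<open>T0\<close> miss \<open>e0\<close>, which also lies inside
    \<open>W\<close>; this one extra edge is what breaks sparseness.\<close>
  also have "(\<Union>i<m. ind (T0 i) W) \<subseteq> ind F W - {e0}"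
    using packing_subset[OF T0] e0(2) unfolding ind_def by blast
  then have "card (\<Union>i<m. ind (T0 i) W) \<le> card (ind F W - {e0})"
    using finite_ind[OF FE] by (intro card_mono) simp_all
  also have "\<dots> < card (ind F W)"
    using \<open>e0 \<in> ind F W\<close> finite_ind[OF FE] by (intro card_Diff1_less)
  finally have "m * card W < card (ind F W) + m" by simp
  moreover have "card (ind F W) + m \<le> m * card W"
    using assms WV x0W unfolding sparse_def by blast
  ultimately show False by simp
qed

end

lemma sparse_forest_decomposition:
  assumes "sparse m F"
  obtains T where "packing m F T" "covered m T = F"
proof -
  have FE: "F \<subseteq> E" using assms unfolding sparse_def by blast
  have "packing m F (\<lambda>i. {})" unfolding packing_def forest_def by simp
  moreover have "card (covered m T) \<le> card F" if "packing m F T" for T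
    using packing_subset[OF that] finite_edges[OF FE] by (intro card_mono) blast+
  ultimately obtain T where "packing m F T"
      "\<And>T'. packing m F T' \<Longrightarrow> card (covered m T') \<le> card (covered m T)"
    using ex_has_greatest_nat[of "packing m F" "\<lambda>i. {}" "\<lambda>T. card (covered m T)" "card F + 1"]
    by (metis le_imp_less_Suc Suc_eq_plus1)
  then show ?thesis using that maximal_packing_covers[OF FE _ _ assms] by blast
qed

section \<open>Bases and spanning trees\<close>

definition tight :: "nat \<Rightarrow> 'e set \<Rightarrow> 'v set \<Rightarrow> bool" where
  "tight m F Q \<longleftrightarrow> Q \<subseteq> V \<and> Q \<noteq> {} \<and> card (ind F Q) + m = m * card Q"

definition basis :: "nat \<Rightarrow> 'e set \<Rightarrow> bool" where
  "basis m F \<longleftrightarrow> sparse m F \<and> tight m F V"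

lemma ind_V: "F \<subseteq> E \<Longrightarrow> ind F V = F"
  unfolding ind_def using ends_sub by blast

text \<open>The \<open>m\<close> forests together have \<open>m\<close> times the largest possible
  number of edges of a forest, so each of them attains it and is spanning.\<close>

lemma basis_spanning_trees:
  assumes "basis m F"
  obtains T where "packing m F T" "\<And>i x y. i < m \<Longrightarrow> x \<in> V \<Longrightarrow> y \<in> V \<Longrightarrow> (x, y) \<in> conn (T i)"
proof -
  have FE: "F \<subseteq> E" and sp: "sparse m F" and cF: "card F + m = m * card V"
    using assms ind_V unfolding basis_def sparse_def tight_def by auto
  obtain T where T: "packing m F T" "covered m T = F"
    using sparse_forest_decomposition[OF sp] by blast
  have Ti: "T i \<subseteq> E" "forest (T i)" if "i < m" for i
    using packingD[OF T(1) that] FE by blast+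
  have "card F = (\<Sum>i<m. card (T i))"
    unfolding T(2)[symmetric] using packing_disjoint[OF T(1)] Ti finite_edges
    by (intro card_UN_disjoint) auto
  then have "(\<Sum>i<m. card (T i) + 1) = (\<Sum>i<m. card V)"
    using cF by (simp only: sum.distrib) simp
  then have "card (T i) + 1 = card V" if "i < m" for i
    using sum_mono_inv[of "\<lambda>i. card (T i) + 1" "{..<m}" "\<lambda>i. card V" i] that Ti forest_card_le
    by simp
  then have "(x, y) \<in> conn (T i)" if "i < m" "x \<in> V" "y \<in> V" for i x y
    using forest_spanning[OF Ti[OF that(1)]] that by blast
  then show ?thesis by (rule that[OF T(1)])
qed

subsection \<open>Tight sets\<close>

lemma sparseD:
  assumes "sparse m F"
  shows sparse_subset: "F \<subseteq> E"
    and sparse_le: "Q \<subseteq> V \<Longrightarrow> Q \<noteq> {} \<Longrightarrow> card (ind F Q) + m \<le> m * card Q"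
  using assms unfolding sparse_def by simp_all

lemma tightD:
  assumes "tight m F Q"
  shows tight_subset: "Q \<subseteq> V" and tight_nonempty: "Q \<noteq> {}"
    and tight_card: "card (ind F Q) + m = m * card Q"
  using assms unfolding tight_def by simp_all

lemma basisD:
  assumes "basis m F"
  shows basis_sparse: "sparse m F" and basis_subset: "F \<subseteq> E" and basis_tight: "tight m F V"
    and basis_card: "card F + m = m * card V"
  using assms ind_V[of F] unfolding basis_def sparse_def tight_def by simp_all

lemma basisI:
  assumes "F \<subseteq> E" "card F + m = m * card V"
    and "\<And>Q. Q \<subseteq> V \<Longrightarrow> Q \<noteq> {} \<Longrightarrow> card (ind F Q) + m \<le> m * card Q"
  shows "basis m F"
  using assms neV ind_V[of F] unfolding basis_def sparse_def tight_def by simp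

lemma ind_mono: "Q \<subseteq> R \<Longrightarrow> ind F Q \<subseteq> ind F R"
  unfolding ind_def by blast

lemma ind_empty: "F \<subseteq> E \<Longrightarrow> ind F {} = {}"
  unfolding ind_def using ends_nonempty by blast

lemma finite_sub: "Q \<subseteq> V \<Longrightarrow> finite Q"
  using finV finite_subset by blast

lemma ind_supermodular:
  assumes "F \<subseteq> E"
  shows "card (ind F A) + card (ind F B) \<le> card (ind F (A \<union> B)) + card (ind F (A \<inter> B))"
proof -
  have "card (ind F A) + card (ind F B) = card (ind F A \<union> ind F B) + card (ind F A \<inter> ind F B)"
    using assms finite_ind by (intro card_Un_Int)
  moreover have "card (ind F A \<union> ind F B) \<le> card (ind F (A \<union> B))"
    using assms finite_ind by (intro card_mono) (auto simp: ind_def)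
  moreover have "ind F A \<inter> ind F B = ind F (A \<inter> B)" unfolding ind_def by blast
  ultimately show ?thesis by simp
qed

text \<open>Uncrossing: \<open>ind_supermodular\<close> bounds the sum of the two counts from below
  and sparseness bounds each of them from above, so there is no slack. Sparseness applies to the
  intersection because it is nonempty.\<close>

lemma tight_Un_Int:
  assumes "sparse m F" "tight m F A" "tight m F B" "A \<inter> B \<noteq> {}"
  shows "tight m F (A \<union> B) \<and> tight m F (A \<inter> B)"
proof -
  note A = tightD[OF assms(2)] and B = tightD[OF assms(3)]
  have "card (ind F (A \<union> B)) + m \<le> m * card (A \<union> B)"
      "card (ind F (A \<inter> B)) + m \<le> m * card (A \<inter> B)"
    using A B assms(4) by (auto intro!: sparse_le[OF assms(1)])
  moreover have "m * card A + m * card B = m * card (A \<union> B) + m * card (A \<inter> B)"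
    using card_Un_Int[of A B] finite_sub A(1) B(1) by (metis distrib_left)
  moreover note ind_supermodular[OF sparse_subset[OF assms(1)], of A B] A(3) B(3)
  ultimately have "card (ind F (A \<union> B)) + m = m * card (A \<union> B)"
      "card (ind F (A \<inter> B)) + m = m * card (A \<inter> B)"
    by linarith+
  then show ?thesis using A(1,2) B(1) assms(4) unfolding tight_def by blast
qed

lemma tight_singleton:
  assumes "F \<subseteq> E" "v \<in> V"
  shows "tight m F {v}"
proof -
  have "ind F {v} = {}"
  proof (rule ccontr)
    assume "ind F {v} \<noteq> {}"
    then obtain e where "e \<in> F" "\<delta> e \<subseteq> {v}" unfolding ind_def by blast
    then show False
      using ends_card[of e] assms(1) card_mono[of "{v}" "\<delta> e"] by auto
  qed
  then show ?thesis using assms(2) unfolding tight_def by simp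
qed

text \<open>All tight sets around \<open>x\<close> and \<open>y\<close> meet, so they are closed
  under intersection and a smallest one lies in all others. If an edge outside \<open>F\<close>
  joins \<open>x\<close> and \<open>y\<close>, any edge of \<open>F\<close> inside this set can be
  swapped for it, by \<open>basis_exchange\<close>.\<close>

lemma minimal_tight:
  assumes "basis m F" "x \<in> V" "y \<in> V"
  obtains Q where "tight m F Q" "x \<in> Q" "y \<in> Q"
    "\<And>R. tight m F R \<Longrightarrow> x \<in> R \<Longrightarrow> y \<in> R \<Longrightarrow> Q \<subseteq> R"
proof -
  let ?P = "\<lambda>Q. tight m F Q \<and> x \<in> Q \<and> y \<in> Q"
  have "?P V" using assms basis_tight by blast
  then obtain Q where Q: "?P Q" "\<And>R. ?P R \<Longrightarrow> card Q \<le> card R"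
    using ex_has_least_nat[of ?P V card] by blast
  have "Q \<subseteq> R" if R: "?P R" for R
  proof -
    have "Q \<inter> R \<noteq> {}" using Q(1) R by blast
    then have "tight m F (Q \<inter> R)"
      using tight_Un_Int[OF basis_sparse[OF assms(1)]] Q(1) R by blast
    then have "card Q \<le> card (Q \<inter> R)" using Q R by blast
    moreover have "finite Q" using Q(1) finite_sub[OF tight_subset] by blast
    ultimately have "Q \<inter> R = Q" by (intro card_seteq) simp_all
    then show ?thesis by blast
  qed
  then show ?thesis using that Q(1) by blast
qed

text \<open>Adding \<open>e\<close> can overfill only a tight set containing both its ends; such a
  set contains \<open>Q\<close> and thus loses \<open>f\<close>.\<close>

lemma basis_exchange:
  assumes "basis m F" "e \<in> E - F" "\<delta> e = {x, y}" "f \<in> ind F Q"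
    and min: "\<And>R. tight m F R \<Longrightarrow> x \<in> R \<Longrightarrow> y \<in> R \<Longrightarrow> Q \<subseteq> R"
  shows "basis m (insert e (F - {f}))"
proof (rule basisI)
  note F = basisD[OF assms(1)]
  have f: "f \<in> F" using assms(4) unfolding ind_def by blast
  have finF: "finite F" using F(2) finite_edges by blast
  show "insert e (F - {f}) \<subseteq> E" using F(2) assms(2) by blast
  have "card (insert e (F - {f})) = card F"
    using card.remove[OF finF f] finF assms(2) by (simp only: card_insert_disjoint finite_Diff) simp
  then show "card (insert e (F - {f})) + m = m * card V" using F(4) by simp
  fix R assume R: "R \<subseteq> V" "R \<noteq> {}"
  have le: "card (ind F R) + m \<le> m * card R" using sparse_le[OF F(1) R] .
  have fin: "finite (ind F R)" using F(2) finite_ind by blast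
  show "card (ind (insert e (F - {f})) R) + m \<le> m * card R"
  proof (cases "\<delta> e \<subseteq> R")
    case False
    then have "card (ind (insert e (F - {f})) R) \<le> card (ind F R)"
      using fin by (intro card_mono) (auto simp: ind_def)
    then show ?thesis using le by simp
  next
    case True
    have "ind (insert e (F - {f})) R \<subseteq> insert e (ind F R - {f})" unfolding ind_def by blast
    then have "card (ind (insert e (F - {f})) R) \<le> card (insert e (ind F R - {f}))"
      using fin by (intro card_mono) simp_all
    also have "\<dots> \<le> card (ind F R - {f}) + 1" using fin by (simp add: card_insert_le_m1 card_insert_if)
    finally have 1: "card (ind (insert e (F - {f})) R) \<le> card (ind F R - {f}) + 1" .
    show ?thesis
    proof (cases "tight m F R")
      case True
      then have "Q \<subseteq> R" using min \<open>\<delta> e \<subseteq> R\<close> assms(3) by simp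
      then have "f \<in> ind F R" using assms(4) ind_mono by blast
      then have "card (ind F R - {f}) < card (ind F R)" using fin by (intro card_Diff1_less)
      then show ?thesis using 1 le by linarith
    next
      case False
      then have "card (ind F R) + m \<noteq> m * card R" using R unfolding tight_def by blast
      moreover have "card (ind F R - {f}) \<le> card (ind F R)" using fin by (intro card_mono) auto
      ultimately show ?thesis using 1 le by linarith
    qed
  qed
qed

text \<open>Only sets \<open>R\<close> meeting \<open>C\<close> are affected. Tightness of
  \<open>F\<close> on \<open>C\<close> turns supermodularity into a bound on the edges of
  \<open>F\<close> in \<open>R\<close> that are not inside \<open>R \<inter> C\<close>, and
  sparseness of \<open>K\<close> bounds the edges put inside it.\<close>

lemma basis_replace:
  assumes "basis m F" "tight m F C" "basis m K" "tight m K C"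
  shows "basis m ((F - ind F C) \<union> ind K C)"
proof (rule basisI)
  let ?N = "(F - ind F C) \<union> ind K C"
  note F = basisD[OF assms(1)] and K = basisD[OF assms(3)]
    and C = tightD[OF assms(2)] and CK = tightD[OF assms(4)]
  show sub: "?N \<subseteq> E" using F(2) K(2) unfolding ind_def by blast
  have cnt: "card (ind ?N R) + card (ind F (R \<inter> C)) = card (ind F R) + card (ind K (R \<inter> C))" for R
  proof -
    have "ind ?N R = (ind F R - ind F (R \<inter> C)) \<union> ind K (R \<inter> C)"
      unfolding ind_def by blast
    moreover have "(ind F R - ind F (R \<inter> C)) \<inter> ind K (R \<inter> C) = {}"
      unfolding ind_def by blast
    ultimately have "card (ind ?N R) = card (ind F R - ind F (R \<inter> C)) + card (ind K (R \<inter> C))"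
      using finite_ind F(2) K(2) by (simp add: card_Un_disjoint)
    moreover have "card (ind F R) = card (ind F R - ind F (R \<inter> C)) + card (ind F (R \<inter> C))"
      using finite_ind[OF F(2)] ind_mono[of "R \<inter> C" R F]
      by (metis Int_lower1 card_Diff_subset card_mono diff_add)
    ultimately show ?thesis by simp
  qed
  have "V \<inter> C = C" using C(1) by blast
  then have "card (ind ?N V) + card (ind F C) = card (ind F V) + card (ind K C)"
    using cnt[of V] by simp
  moreover have "card (ind F C) = card (ind K C)" using C(3) CK(3) by linarith
  ultimately show "card ?N + m = m * card V"
    using ind_V[OF sub] ind_V[OF F(2)] F(4) by simp
  fix R assume R: "R \<subseteq> V" "R \<noteq> {}"
  show "card (ind ?N R) + m \<le> m * card R"
  proof (cases "R \<inter> C = {}")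
    case True
    have "card (ind F R) + m \<le> m * card R" using sparse_le[OF F(1) R] .
    then show ?thesis using cnt[of R] ind_empty F(2) K(2) unfolding True by simp
  next
    case False
    have "card (ind F R) + card (ind F C) \<le> card (ind F (R \<union> C)) + card (ind F (R \<inter> C))"
      by (rule ind_supermodular[OF F(2)])
    moreover have "card (ind F (R \<union> C)) + m \<le> m * card (R \<union> C)"
      using R C(1) by (intro sparse_le[OF F(1)]) auto
    moreover have "card (ind K (R \<inter> C)) + m \<le> m * card (R \<inter> C)"
      using R C(1) False by (intro sparse_le[OF K(1)]) auto
    moreover have "m * card R + m * card C = m * card (R \<union> C) + m * card (R \<inter> C)"
      using card_Un_Int[of R C] finite_sub R(1) C(1) by (metis distrib_left)
    ultimately show ?thesis using cnt[of R] C(3) by linarith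
  qed
qed

text \<open>Agreement outside the edges spanned by \<open>R\<close> is written as equality after
  removing \<open>ind E R\<close>. All bases have the same size, so the removed parts have equal
  size too.\<close>

lemma agree_card:
  assumes "basis m F" "basis m K" "F - ind E R = K - ind E R"
  shows "card (ind F R) = card (ind K R)"
proof -
  have split: "card N = card (N - ind E R) + card (ind N R)" if "N \<subseteq> E" for N
  proof -
    have "finite N" using that finite_edges by blast
    moreover have "N \<inter> ind E R = ind N R" using that unfolding ind_def by blast
    ultimately show ?thesis
      using card_Int_Diff[of N "ind E R"] by simp
  qed
  note F = basisD[OF assms(1)] and K = basisD[OF assms(2)]
  have "card F = card K" using F(4) K(4) by linarith
  then show ?thesis using split[OF F(2)] split[OF K(2)] assms(3) by simp
qed

lemma agree_tight:
  assumes "basis m F" "basis m K" "F - ind E R = K - ind E R"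
  shows "tight m F R \<longleftrightarrow> tight m K R"
  using agree_card[OF assms] unfolding tight_def by simp

lemma agree_mono:
  assumes "F - ind E C = K - ind E C" "C \<subseteq> R"
  shows "F - ind E R = K - ind E R"
proof -
  have "ind E C \<subseteq> ind E R" using ind_mono[OF assms(2)] .
  then show ?thesis using assms(1) by blast
qed

lemma agree_deg:
  assumes "F - ind E C = K - ind E C" "v \<notin> C"
  shows "deg F v = deg K v"
proof -
  have "e \<notin> ind E C" if "v \<in> \<delta> e" for e using that assms(2) unfolding ind_def by blast
  then have "{e \<in> F. v \<in> \<delta> e} = {e \<in> K. v \<in> \<delta> e}" using assms(1) by blast
  then show ?thesis unfolding deg_def by simp
qed

text \<open>
  Otherwise \<open>v\<close> has at most \<open>m\<close> edges inside \<open>Q\<close>, so \<open>Q - {v}\<close> is tight as well.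
\<close>

lemma minimal_tight_edge:
  assumes "basis m F" "tight m F Q" "x \<in> Q" "y \<in> Q" "v \<in> Q" "v \<noteq> x" "v \<noteq> y"
    and min: "\<And>R. tight m F R \<Longrightarrow> x \<in> R \<Longrightarrow> y \<in> R \<Longrightarrow> Q \<subseteq> R"
    and "deg M v \<le> m" "M \<subseteq> E"
  obtains f where "f \<in> ind F Q" "v \<in> \<delta> f" "f \<notin> M"
proof (rule ccontr)
  assume "\<not> thesis"
  then have sub: "{f \<in> ind F Q. v \<in> \<delta> f} \<subseteq> {f \<in> M. v \<in> \<delta> f}" using that by blast
  note F = basisD[OF assms(1)] and Q = tightD[OF assms(2)]
  let ?Q = "Q - {v}"
  have "finite M" using assms(10) finite_edges by blast
  then have "card {f \<in> ind F Q. v \<in> \<delta> f} \<le> m"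
    using card_mono[OF _ sub] assms(9) unfolding deg_def by simp
  moreover have "card (ind F Q) = card (ind F ?Q) + card {f \<in> ind F Q. v \<in> \<delta> f}"
  proof -
    have "ind F Q = ind F ?Q \<union> {f \<in> ind F Q. v \<in> \<delta> f}"
        "ind F ?Q \<inter> {f \<in> ind F Q. v \<in> \<delta> f} = {}"
      unfolding ind_def by blast+
    then show ?thesis
      using card_Un_disjoint[of "ind F ?Q" "{f \<in> ind F Q. v \<in> \<delta> f}"] finite_ind[OF F(2)] by simp
  qed
  moreover have "card Q = card ?Q + 1"
    using card.remove[of Q v] assms(5) finite_sub[OF Q(1)] by simp
  then have "m * card Q = m * card ?Q + m" by simp
  moreover have ne: "?Q \<noteq> {}" and subV: "?Q \<subseteq> V" using assms(3,6) Q(1) by blast+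
  then have "card (ind F ?Q) + m \<le> m * card ?Q" by (intro sparse_le[OF F(1)])
  ultimately have "card (ind F ?Q) + m = m * card ?Q" using Q(3) by linarith
  then have "tight m F ?Q" using ne subV unfolding tight_def by blast
  then have "Q \<subseteq> ?Q" using min assms(3,4,6,7) by blast
  then show False using assms(5) by blast
qed

section \<open>Maximal tight sets avoiding a vertex set\<close>

definition comp :: "nat \<Rightarrow> 'e set \<Rightarrow> 'v set \<Rightarrow> 'v \<Rightarrow> 'v set" where
  "comp m F S v = \<Union>{C. tight m F C \<and> C \<subseteq> V - S \<and> v \<in> C}"

lemma comp_subset: "comp m F S v \<subseteq> V - S"
  unfolding comp_def by blast

lemma comp_max: "tight m F R \<Longrightarrow> R \<subseteq> V - S \<Longrightarrow> v \<in> R \<Longrightarrow> R \<subseteq> comp m F S v"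
  unfolding comp_def by blast

text \<open>The tight sets around \<open>v\<close> that avoid \<open>S\<close> share
  \<open>v\<close>, so they are closed under union and the union in \<open>comp\<close> is the
  largest of them; \<open>{v}\<close> shows that there is one.\<close>

lemma
  assumes "sparse m F" "v \<in> V - S"
  shows comp_tight: "tight m F (comp m F S v)" and comp_self: "v \<in> comp m F S v"
proof -
  let ?T = "{C. tight m F C \<and> C \<subseteq> V - S \<and> v \<in> C}"
  have sing: "{v} \<in> ?T" using tight_singleton[OF sparse_subset[OF assms(1)]] assms(2) by blast
  then show "v \<in> comp m F S v" unfolding comp_def by blast
  have "?T \<subseteq> Pow V" by blast
  then have "finite ?T" using finV by (metis finite_Pow_iff finite_subset)
  then obtain C where C: "C \<in> ?T" "\<And>D. D \<in> ?T \<Longrightarrow> C \<subseteq> D \<Longrightarrow> D = C"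
    using finite_has_maximal[of ?T] sing by (metis (no_types, lifting) empty_iff)
  have "D \<subseteq> C" if D: "D \<in> ?T" for D
  proof -
    have "tight m F (C \<union> D)" using tight_Un_Int[OF assms(1), of C D] C(1) D by blast
    then have "C \<union> D \<in> ?T" using C(1) D by blast
    then have "C \<union> D = C" using C(2) by blast
    then show ?thesis by blast
  qed
  then have "comp m F S v = C" using C(1) unfolding comp_def by blast
  then show "tight m F (comp m F S v)" using C(1) by simp
qed

text \<open>Together with \<open>comp_self\<close> this makes the components a partition of
  \<open>V - S\<close>, with \<open>comp m F S\<close> as a labelling for
  \<open>crossing\<close>.\<close>

lemma comp_eq:
  assumes "sparse m F" "v \<in> V - S" "w \<in> comp m F S v"
  shows "comp m F S w = comp m F S v"
proof -
  have w: "w \<in> V - S" using assms(3) comp_subset by blast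
  have 1: "comp m F S v \<subseteq> comp m F S w"
    using comp_max[OF comp_tight[OF assms(1,2)] comp_subset assms(3)] .
  then have "v \<in> comp m F S w" using comp_self[OF assms(1,2)] by blast
  then have "comp m F S w \<subseteq> comp m F S v"
    using comp_max[OF comp_tight[OF assms(1) w] comp_subset] by blast
  with 1 show ?thesis by blast
qed

lemma comp_empty:
  assumes "basis m F" "v \<in> V"
  shows "comp m F {} v = V"
proof
  show "comp m F {} v \<subseteq> V" using comp_subset[of m F "{}" v] by simp
  show "V \<subseteq> comp m F {} v" using comp_max[OF basis_tight[OF assms(1)]] assms(2) by simp
qed

lemma comp_card:
  assumes "sparse m F" "S \<subseteq> V"
  shows "card (\<Union>v\<in>V - S. ind F (comp m F S v)) + m * card (comp m F S ` (V - S))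
    = m * card (V - S)"
proof -
  let ?P = "comp m F S ` (V - S)"
  have FE: "F \<subseteq> E" using sparse_subset[OF assms(1)] .
  have finP: "finite ?P" using finV by simp
  have disj: "P \<inter> R = {}" if PR: "P \<in> ?P" "R \<in> ?P" "P \<noteq> R" for P R
  proof (rule ccontr)
    assume "P \<inter> R \<noteq> {}"
    then obtain w where w: "w \<in> P" "w \<in> R" by blast
    then have "P = comp m F S w" "R = comp m F S w"
      using PR(1,2) comp_eq[OF assms(1)] by blast+
    then show False using PR(3) by simp
  qed
  have "card (\<Union>v\<in>V - S. ind F (comp m F S v)) = card (\<Union>P\<in>?P. ind F P)" by simp
  also have "\<dots> = (\<Sum>P\<in>?P. card (ind F P))"
  proof (rule card_UN_disjoint[OF finP])
    show "\<forall>P\<in>?P. finite (ind F P)" using finite_ind[OF FE] by blast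
    show "\<forall>P\<in>?P. \<forall>R\<in>?P. P \<noteq> R \<longrightarrow> ind F P \<inter> ind F R = {}"
    proof (intro ballI impI)
      fix P R assume "P \<in> ?P" "R \<in> ?P" "P \<noteq> R"
      then have "P \<inter> R = {}" by (rule disj)
      then show "ind F P \<inter> ind F R = {}"
        using ends_nonempty FE unfolding ind_def by blast
    qed
  qed
  finally have 1: "card (\<Union>v\<in>V - S. ind F (comp m F S v)) = (\<Sum>P\<in>?P. card (ind F P))" .
  have "(\<Sum>P\<in>?P. card (ind F P)) + m * card ?P = (\<Sum>P\<in>?P. card (ind F P) + m)"
    by (simp only: sum.distrib) simp
  also have "\<dots> = (\<Sum>P\<in>?P. m * card P)"
  proof (rule sum.cong[OF refl])
    fix P assume "P \<in> ?P"
    then have "tight m F P" using comp_tight[OF assms(1)] by blast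
    then show "card (ind F P) + m = m * card P" by (rule tight_card)
  qed
  also have "\<dots> = m * (\<Sum>P\<in>?P. card P)" by (simp add: sum_distrib_left)
  also have "(\<Sum>P\<in>?P. card P) = card (\<Union>?P)"
  proof (rule card_Union_disjoint[symmetric])
    show "pairwise disjnt ?P" using disj unfolding pairwise_def disjnt_def by blast
    fix P assume "P \<in> ?P"
    then have "P \<subseteq> V" using comp_subset[of m F S] by blast
    then show "finite P" by (rule finite_sub)
  qed
  also have "\<Union>?P = V - S"
  proof
    show "\<Union>?P \<subseteq> V - S" using comp_subset by (intro UN_least)
    show "V - S \<subseteq> \<Union>?P" using comp_self[OF assms(1)] by (intro subsetI UN_I)
  qed
  finally show ?thesis using 1 by simp
qed

text \<open>An edge of \<open>F\<close> meets \<open>S\<close>, lies inside one component or crosses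
  between two of them. Tightness determines how many lie inside components, through
  \<open>comp_card\<close>.\<close>

lemma edge_split:
  assumes "sparse m F" "S \<subseteq> V"
  shows "card F + m * card (comp m F S ` (V - S)) =
    m * card (V - S) + card {e \<in> F. \<delta> e \<inter> S \<noteq> {}} + card (crossing (ind F (V - S)) (comp m F S))"
proof -
  let ?A = "\<Union>v\<in>V - S. ind F (comp m F S v)" and ?B = "{e \<in> F. \<delta> e \<inter> S \<noteq> {}}"
    and ?C = "crossing (ind F (V - S)) (comp m F S)"
  have FE: "F \<subseteq> E" using sparse_subset[OF assms(1)] .
  have fin: "finite F" using finite_edges[OF FE] .
  have sub: "?A \<subseteq> F" "?B \<subseteq> F" "?C \<subseteq> F" unfolding ind_def crossing_def by blast+
  have A: "\<delta> e \<subseteq> V - S" if "e \<in> ?A" for e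
    using that comp_subset unfolding ind_def by blast
  have "e \<in> ?A \<union> ?B \<union> ?C" if e: "e \<in> F" for e
  proof -
    have "e \<in> E" using e FE by blast
    then obtain x y where xy: "\<delta> e = {x, y}" "x \<in> V" "y \<in> V" by (rule ends_obtain)
    show ?thesis
    proof (cases "\<delta> e \<inter> S = {}")
      case True
      then have VS: "x \<in> V - S" "y \<in> V - S" using xy by auto
      then have e': "e \<in> ind F (V - S)" using e by (simp add: ind_def xy(1))
      show ?thesis
      proof (cases "comp m F S x = comp m F S y")
        case True
        then have "\<delta> e \<subseteq> comp m F S x"
          using comp_self[OF assms(1) VS(1)] comp_self[OF assms(1) VS(2)] xy(1) by simp
        then have "e \<in> ind F (comp m F S x)" using e by (simp add: ind_def)
        then show ?thesis using VS(1) by blast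
      next
        case False
        then have "e \<in> ?C" using e' by (auto simp: crossing_def xy(1))
        then show ?thesis by (rule UnI2)
      qed
    qed (use e in blast)
  qed
  then have "F \<subseteq> ?A \<union> ?B \<union> ?C" by (rule subsetI)
  then have "F = ?A \<union> ?B \<union> ?C" using sub by (intro equalityI Un_least)
  moreover have "?A \<inter> ?B = {}"
  proof -
    have "e \<notin> ?B" if "e \<in> ?A" for e using A[OF that] by blast
    then show ?thesis by (rule disjoint_iff[THEN iffD2, rule_format])
  qed
  moreover have "(?A \<union> ?B) \<inter> ?C = {}"
  proof -
    have "e \<notin> ?C" if eA: "e \<in> ?A" for e
    proof -
      obtain v where v: "v \<in> V - S" "e \<in> ind F (comp m F S v)" using eA by blast
      have "comp m F S x = comp m F S v" if "x \<in> \<delta> e" for x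
        using v(2) that by (intro comp_eq[OF assms(1) v(1)]) (auto simp: ind_def)
      then show ?thesis unfolding crossing_def by simp
    qed
    moreover have "?B \<inter> ?C = {}" unfolding crossing_def ind_def by blast
    ultimately show ?thesis by (simp only: Int_Un_distrib2 Un_empty disjoint_iff) simp
  qed
  ultimately have "card F = card ?A + card ?B + card ?C"
    using card_Un_disjoint[of "?A \<union> ?B" ?C] card_Un_disjoint[of ?A ?B]
      finite_subset[OF sub(1) fin] finite_subset[OF sub(2) fin] finite_subset[OF sub(3) fin]
    by (simp only: finite_UnI)
  then show ?thesis using comp_card[OF assms] by simp
qed

text \<open>In a largest sparse \<open>F\<close> containing \<open>M\<close>, every edge outside
  \<open>F\<close> is spanned by a tight set. Hence all edges between maximal tight sets belong to
  \<open>F\<close>, and \<open>cut\<close> for this partition forces \<open>F\<close> to have full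
  size.\<close>

lemma sparse_extend:
  assumes "sparse m M"
    and cut: "\<And>p :: 'v \<Rightarrow> 'v set. m * card (p ` V) \<le> card (crossing E p) + m"
  obtains F where "basis m F" "M \<subseteq> F"
proof -
  let ?P = "\<lambda>F. sparse m F \<and> M \<subseteq> F"
  have "card F < card E + 1" if "?P F" for F
    using card_mono[OF finE sparse_subset[of m F]] that by simp
  then obtain F where F: "sparse m F" "M \<subseteq> F" and max: "\<And>K. ?P K \<Longrightarrow> card K \<le> card F"
    using ex_has_greatest_nat[of ?P M card "card E + 1"] assms(1) by blast
  have FE: "F \<subseteq> E" using sparse_subset[OF F(1)] .
  have finF: "finite F" using finite_edges[OF FE] .
  let ?c = "comp m F {}"
  have "crossing E ?c \<subseteq> F"
  proof
    fix e assume e: "e \<in> crossing E ?c"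
    show "e \<in> F"
    proof (rule ccontr)
      assume eF: "e \<notin> F"
      have eE: "e \<in> E" using e unfolding crossing_def by simp
      have "\<not> sparse m (insert e F)"
        using max[of "insert e F"] F(2) eF finF by auto
      then obtain R where R: "R \<subseteq> V" "R \<noteq> {}" "m * card R < card (ind (insert e F) R) + m"
        using eE FE unfolding sparse_def by (auto simp: not_le)
      have le: "card (ind F R) + m \<le> m * card R" using sparse_le[OF F(1) R(1,2)] .
      have eR: "\<delta> e \<subseteq> R"
      proof (rule ccontr)
        assume "\<not> \<delta> e \<subseteq> R"
        then have "ind (insert e F) R = ind F R" unfolding ind_def by blast
        then show False using R(3) le by simp
      qed
      have "ind (insert e F) R = insert e (ind F R)" using eR unfolding ind_def by blast
      then have "card (ind (insert e F) R) \<le> card (ind F R) + 1"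
        by (simp add: card_insert_if finite_ind[OF FE])
      then have "tight m F R" using R le unfolding tight_def by simp
      then have sub: "R \<subseteq> ?c x" if "x \<in> R" for x using comp_max[of m F R "{}" x] R(1) that by simp
      have "?c x = ?c y" if "x \<in> \<delta> e" "y \<in> \<delta> e" for x y
      proof -
        have "x \<in> R" "y \<in> R" "y \<in> V" using that eR R(1) by auto
        then have "x \<in> ?c y" using sub[of y] by blast
        then show ?thesis using comp_eq[OF F(1), of y "{}" x] \<open>y \<in> V\<close> by simp
      qed
      then show False using e unfolding crossing_def by blast
    qed
  qed
  then have "crossing E ?c \<subseteq> crossing F ?c" unfolding crossing_def by blast
  then have "card (crossing E ?c) \<le> card (crossing F ?c)"
    using finF by (intro card_mono) (auto simp: crossing_def)
  moreover have "card F + m * card (?c ` V) = m * card V + card (crossing F ?c)"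
    using edge_split[OF F(1), of "{}"] ind_V[OF FE] by simp
  ultimately have "m * card V \<le> card F + m" using cut[of ?c] by linarith
  moreover have "card F + m \<le> m * card V"
    using sparse_le[OF F(1), of V] neV ind_V[OF FE] by simp
  ultimately have "basis m F" using sparse_le[OF F(1)] by (intro basisI[OF FE]) simp_all
  then show ?thesis using that F(2) by blast
qed

lemma agree_disjoint:
  assumes "K - ind E A = F - ind E A" "A \<inter> B = {}" "K \<subseteq> E" "F \<subseteq> E"
  shows "ind K B = ind F B"
proof -
  have "g \<notin> ind E A" if "g \<in> E" "\<delta> g \<subseteq> B" for g
    using ends_nonempty[OF that(1)] that(2) assms(2) unfolding ind_def by blast
  then have "ind N B = ind (N - ind E A) B" if "N \<subseteq> E" for N
    using that unfolding ind_def by blast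
  then show ?thesis using assms(1,3,4) by metis
qed

text \<open>Disjoint tight sets can be rewired independently: \<open>K\<close> has the edges of
  \<open>F\<close> inside \<open>B\<close>, so \<open>B\<close> is still tight there and its
  interior can be replaced by that of \<open>L\<close>.\<close>

lemma combine_bases:
  assumes "basis m F" "tight m F A" "tight m F B" "A \<inter> B = {}"
    and K: "basis m K" "K - ind E A = F - ind E A"
    and L: "basis m L" "L - ind E B = F - ind E B"
  obtains N where "basis m N" "N - ind E B = K - ind E B" "N - ind E A = L - ind E A"
    "K \<inter> L \<subseteq> N" "tight m N A" "tight m N B"
proof -
  note FE = basis_subset[OF assms(1)] and KE = basis_subset[OF K(1)]
    and LE = basis_subset[OF L(1)]
  have disj': "B \<inter> A = {}" using assms(4) by blast
  have "ind K B = ind F B" using agree_disjoint[OF K(2) assms(4) KE FE] .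
  then have tKB: "tight m K B" using assms(3) unfolding tight_def by simp
  have "ind L A = ind F A" using agree_disjoint[OF L(2) disj' LE FE] .
  then have tLA: "tight m L A" using assms(2) unfolding tight_def by simp
  have tLB: "tight m L B" using agree_tight[OF L(1) assms(1) L(2)] assms(3) by simp
  define N where "N = (K - ind K B) \<union> ind L B"
  have bN: "basis m N" unfolding N_def by (rule basis_replace[OF K(1) tKB L(1) tLB])
  have NK: "N - ind E B = K - ind E B" using KE LE unfolding N_def ind_def by blast
  have NB: "g \<in> N \<longleftrightarrow> g \<in> L" if "g \<in> ind E B" for g
    using that unfolding N_def ind_def by blast
  have NL: "N - ind E A = L - ind E A"
  proof -
    have "g \<in> N \<longleftrightarrow> g \<in> L" if "g \<notin> ind E A" for g
    proof (cases "g \<in> ind E B")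
      case False
      then show ?thesis using NK K(2) L(2) that by blast
    qed (rule NB)
    then show ?thesis by blast
  qed
  have "K \<inter> L \<subseteq> N" unfolding N_def ind_def by blast
  moreover have "tight m N A" using agree_tight[OF bN L(1) NL] tLA by simp
  moreover have "tight m N B" using agree_tight[OF bN K(1) NK] tKB by simp
  ultimately show ?thesis using that[OF bN NK NL] by blast
qed

subsection \<open>Minimising the total excess\<close>

text \<open>Because of truncated subtraction, a degree below its bound does not compensate for
  excess elsewhere.\<close>

definition excess :: "'v set \<Rightarrow> ('v \<Rightarrow> nat) \<Rightarrow> 'e set \<Rightarrow> nat" where
  "excess X b F = (\<Sum>v\<in>X. deg F v - b v)"

context
  fixes m :: nat and M X b F
  assumes M: "M \<subseteq> E" "\<And>v. v \<in> V \<Longrightarrow> deg M v \<le> m" and X: "X \<subseteq> V"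
    and F: "basis m F" "M \<subseteq> F"
    and minimal: "\<And>K. basis m K \<Longrightarrow> M \<subseteq> K \<Longrightarrow> excess X b F \<le> excess X b K"
begin

text \<open>The largest degree at \<open>v\<close> that does not raise the excess at
  \<open>v\<close> above that of \<open>F\<close>.\<close>

definition cap :: "'v \<Rightarrow> nat" where
  "cap v = max (b v) (deg F v)"

text \<open>
  Bases that differ from \<open>F\<close> only inside \<open>C\<close> and create no new excess. A vertex is blocked at
  stage \<open>n + 1\<close> if no such change inside its component of \<open>F\<close> without the stage-\<open>n\<close> blocked
  vertices makes room for one more edge at it.
\<close>

definition relief :: "'v set \<Rightarrow> 'e set \<Rightarrow> bool" where
  "relief C K \<longleftrightarrow> basis m K \<and> M \<subseteq> K \<and> K - ind E C = F - ind E C \<and> (\<forall>v\<in>X. deg K v \<le> cap v)"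

fun blocked :: "nat \<Rightarrow> 'v set" where
  "blocked 0 = {}"
| "blocked (Suc n) = blocked n \<union>
    {v \<in> X. v \<notin> blocked n \<and> (\<forall>K. relief (comp m F (blocked n) v) K \<longrightarrow> cap v \<le> deg K v)}"

declare blocked.simps(2) [simp del]

lemma blocked_mono: "blocked n \<subseteq> blocked (Suc n)"
  by (simp add: blocked.simps(2))

lemma blocked_subset: "blocked n \<subseteq> X"
  by (induction n) (auto simp: blocked.simps(2))

lemma relief_refl: "relief C F"
  unfolding relief_def cap_def using F by simp

text \<open>\<open>F\<close> itself competes in the definition of \<open>blocked\<close>, so its own
  degree at a blocked vertex reaches \<open>cap\<close>.\<close>

lemma blocked_deg: "v \<in> blocked n \<Longrightarrow> b v \<le> deg F v"
proof (induction n)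
  case (Suc n)
  show ?case
  proof (cases "v \<in> blocked n")
    case False
    then have "cap v \<le> deg F v" using Suc.prems relief_refl by (simp add: blocked.simps(2))
    then show ?thesis unfolding cap_def by simp
  qed (rule Suc.IH)
qed simp

text \<open>Lowering the degree at \<open>v\<close> while all others stay within \<open>cap\<close>
  would bring the total excess below that of \<open>F\<close>, which is minimal. So no relief exists
  in any set \<open>C\<close>, in particular at the first stage.\<close>

lemma excess_blocked:
  assumes "v \<in> X" "b v < deg F v"
  shows "v \<in> blocked 1"
proof -
  have "cap v \<le> deg K v" if K: "relief C K" for C K
  proof (rule ccontr)
    assume less: "\<not> cap v \<le> deg K v"
    have le: "deg K w - b w \<le> deg F w - b w" if "w \<in> X" for w
      using K that unfolding relief_def cap_def by fastforce
    moreover have "deg K v - b v < deg F v - b v" using less assms(2) unfolding cap_def by linarith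
    ultimately have "excess X b K < excess X b F"
      unfolding excess_def using assms(1) finite_sub[OF X] by (intro sum_strict_mono_ex1) auto
    then show False using minimal[of K] K unfolding relief_def by simp
  qed
  then show ?thesis using assms(1) by (simp add: blocked.simps(2))
qed

lemma relief_step:
  assumes "x \<in> V - blocked (Suc n)"
  obtains K where "relief (comp m F (blocked n) x) K" "x \<in> X \<longrightarrow> deg K x < cap x"
proof (cases "x \<in> X")
  case True
  then show ?thesis using assms that by (auto simp: not_le blocked.simps(2))
next
  case False
  then show ?thesis using that relief_refl by blast
qed

lemma deg_insert_le:
  assumes "N \<subseteq> E"
  shows "deg (insert e N) v \<le> deg N v + (if v \<in> \<delta> e then 1 else 0)"
proof -
  have fin: "finite {g \<in> N. v \<in> \<delta> g}" using finite_edges[OF assms] by simp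
  show ?thesis
  proof (cases "v \<in> \<delta> e")
    case True
    then have "{g \<in> insert e N. v \<in> \<delta> g} = insert e {g \<in> N. v \<in> \<delta> g}" by blast
    then show ?thesis using fin True unfolding deg_def by (simp add: card_insert_if)
  next
    case False
    then have "{g \<in> insert e N. v \<in> \<delta> g} = {g \<in> N. v \<in> \<delta> g}" by blast
    then show ?thesis using False unfolding deg_def by simp
  qed
qed

text \<open>
  If an edge \<open>e\<close> outside \<open>F\<close> joined two components at the next stage, neither end being blocked
  later, then both ends could be relieved independently. Adding \<open>e\<close> then allows the removal of an
  edge at some blocked vertex inside the minimal tight set around \<open>e\<close>, which relieves that vertex
  one stage too early.
\<close>

lemma blocked_edge:
  assumes "e \<in> E - F" "\<delta> e = {x, y}" "x \<in> V - blocked (Suc n)" "y \<in> V - blocked (Suc n)"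
  shows "comp m F (blocked n) x = comp m F (blocked n) y"
  using assms(3,4)
proof (induction n)
  case 0
  \<comment> \<open>With nothing blocked, all of \<open>V\<close> is one component.\<close>
  then show ?case using comp_empty[OF F(1)] by simp
next
  case (Suc n)
  let ?S = "blocked (Suc n)" and ?S' = "blocked n"
  note sp = basis_sparse[OF F(1)]
  define A where "A = comp m F ?S x"
  define B where "B = comp m F ?S y"
  define D where "D = comp m F ?S' x"
  have sub: "?S' \<subseteq> ?S" by (rule blocked_mono)
  have xy: "x \<in> V - ?S" "y \<in> V - ?S" using Suc.prems blocked_mono[of "Suc n"] by blast+
  then have xy': "x \<in> V - ?S'" "y \<in> V - ?S'" using sub by blast+
  have D_y: "D = comp m F ?S' y" unfolding D_def using Suc.IH xy by blast
  have A: "tight m F A" "x \<in> A" "A \<subseteq> V - ?S" and B: "tight m F B" "y \<in> B" "B \<subseteq> V - ?S"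
    unfolding A_def B_def
    using comp_tight[OF sp xy(1)] comp_tight[OF sp xy(2)] comp_self[OF sp xy(1)]
      comp_self[OF sp xy(2)] comp_subset by simp_all
  have D: "tight m F D" "D \<subseteq> V - ?S'"
    unfolding D_def using comp_tight[OF sp xy'(1)] comp_subset by simp_all
  have AD: "A \<subseteq> D" unfolding D_def using comp_max[OF A(1) _ A(2)] A(3) sub by (meson Diff_mono order_refl order_trans)
  have BD: "B \<subseteq> D" unfolding D_y using comp_max[OF B(1) _ B(2)] B(3) sub by (meson Diff_mono order_refl order_trans)
  show ?case unfolding A_def[symmetric] B_def[symmetric]
  proof (rule ccontr)
    assume AB: "A \<noteq> B"
    have disj: "A \<inter> B = {}"
    proof (rule ccontr)
      assume "A \<inter> B \<noteq> {}"
      then obtain w where w: "w \<in> A" "w \<in> B" by blast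
      have "comp m F ?S w = A" using w(1) unfolding A_def by (rule comp_eq[OF sp xy(1)])
      moreover have "comp m F ?S w = B" using w(2) unfolding B_def by (rule comp_eq[OF sp xy(2)])
      ultimately show False using AB by simp
    qed
    \<comment> \<open>\<open>K\<close> makes room at \<open>x\<close> by changes inside
      \<open>A\<close>, and \<open>L\<close> makes room at \<open>y\<close> by changes inside
      \<open>B\<close>, as far as these ends lie in \<open>X\<close>; \<open>N\<close> below does
      both.\<close>
    obtain K where K: "relief A K" "x \<in> X \<longrightarrow> deg K x < cap x"
      using relief_step[OF Suc.prems(1)] unfolding A_def .
    obtain L where L: "relief B L" "y \<in> X \<longrightarrow> deg L y < cap y"
      using relief_step[OF Suc.prems(2)] unfolding B_def .
    have bK: "basis m K" and M_sub_K: "M \<subseteq> K" and aK: "K - ind E A = F - ind E A"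
      and dK: "\<And>v. v \<in> X \<Longrightarrow> deg K v \<le> cap v"
      using K(1) unfolding relief_def by auto
    have bL: "basis m L" and M_sub_L: "M \<subseteq> L" and aL: "L - ind E B = F - ind E B"
      and dL: "\<And>v. v \<in> X \<Longrightarrow> deg L v \<le> cap v"
      using L(1) unfolding relief_def by auto
    note KE = basis_subset[OF bK] and LE = basis_subset[OF bL] and FE = basis_subset[OF F(1)]
    obtain N where bN: "basis m N" and NK: "N - ind E B = K - ind E B"
      and NL: "N - ind E A = L - ind E A" and KLN: "K \<inter> L \<subseteq> N"
      and tNA: "tight m N A" and tNB: "tight m N B"
      using combine_bases[OF F(1) A(1) B(1) disj bK aK bL aL] .
    have NE: "N \<subseteq> E" using basis_subset[OF bN] .
    have M_sub_N: "M \<subseteq> N" using KLN M_sub_K M_sub_L by (meson Int_greatest order_trans)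
    have agree: "N - ind E R = F - ind E R" if "A \<subseteq> R" "B \<subseteq> R" for R
      using agree_mono[OF NK that(2)] agree_mono[OF aK that(1)] by simp
    have tN: "tight m N R \<longleftrightarrow> tight m F R" if "A \<subseteq> R" "B \<subseteq> R" for R
      using agree_tight[OF bN F(1) agree[OF that]] .
    have degA: "deg N v = deg K v" if "v \<notin> B" for v using agree_deg[OF NK that] .
    have degB: "deg N v = deg L v" if "v \<notin> A" for v using agree_deg[OF NL that] .
    have dN: "deg N v \<le> cap v" if "v \<in> X" for v
      using degA[of v] degB[of v] dK dL that disj by (metis disjoint_iff)
    have "x \<notin> B" "y \<notin> A" using disj A(2) B(2) by blast+
    then have dx: "x \<in> X \<longrightarrow> deg N x < cap x" and dy: "y \<in> X \<longrightarrow> deg N y < cap y"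
      using degA[of x] K(2) degB[of y] L(2) by simp_all
    obtain Q where Q: "tight m N Q" "x \<in> Q" "y \<in> Q"
      and min: "\<And>R. tight m N R \<Longrightarrow> x \<in> R \<Longrightarrow> y \<in> R \<Longrightarrow> Q \<subseteq> R"
      using minimal_tight[OF bN DiffD1[OF xy(1)] DiffD1[OF xy(2)]] by blast
    have tND: "tight m N D" using tN[OF AD BD] D(1) by simp
    have QD: "Q \<subseteq> D" using min[OF tND] AD BD A(2) B(2) by blast
    \<comment> \<open>Otherwise uncrossing makes \<open>Q \<union> A \<union> B\<close> tight in
      \<open>N\<close>, hence in \<open>F\<close>, and it avoids \<open>?S\<close>; the components
      of \<open>x\<close> and \<open>y\<close> would coincide.\<close>
    have "Q \<inter> ?S \<noteq> {}"
    proof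
      assume QS: "Q \<inter> ?S = {}"
      have sN: "sparse m N" using basis_sparse[OF bN] .
      have "Q \<inter> A \<noteq> {}" using Q(2) A(2) by blast
      then have "tight m N (Q \<union> A)" using tight_Un_Int[OF sN Q(1) tNA] by blast
      moreover have "(Q \<union> A) \<inter> B \<noteq> {}" using Q(3) B(2) by blast
      ultimately have "tight m N (Q \<union> A \<union> B)" using tight_Un_Int[OF sN _ tNB] by blast
      then have "tight m F (Q \<union> A \<union> B)" using tN[of "Q \<union> A \<union> B"] by blast
      moreover have "Q \<union> A \<union> B \<subseteq> V - ?S"
        using QS tight_subset[OF Q(1)] A(3) B(3) by blast
      ultimately have "Q \<union> A \<union> B \<subseteq> A" 
        using comp_max[of m F "Q \<union> A \<union> B" ?S x] A(2) unfolding A_def by blast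
      then show False using B(2) disj by blast
    qed
    then obtain v where v: "v \<in> Q" "v \<in> ?S" by blast
    \<comment> \<open>\<open>Q\<close> lies in \<open>D\<close>, so \<open>v\<close> is blocked only
      from stage \<open>Suc n\<close> on, and its component with respect to \<open>?S'\<close> is
      \<open>D\<close>.\<close>
    have vS': "v \<notin> ?S'" using v(1) QD D(2) by blast
    have vX: "v \<in> X" using v(2) blocked_subset by blast
    have vV: "v \<in> V" using vX X by blast
    have vAB: "v \<notin> A" "v \<notin> B" using v(2) A(3) B(3) by blast+
    have vxy: "v \<noteq> x" "v \<noteq> y" using vAB A(2) B(2) by blast+
    obtain f where f: "f \<in> ind N Q" "v \<in> \<delta> f" "f \<notin> M"
      using minimal_tight_edge[OF bN Q v(1) vxy min M(2)[OF vV] M(1)] by blast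
    have eD: "\<delta> e \<subseteq> D" using assms(2) A(2) B(2) AD BD by auto
    have eN: "e \<in> E - N"
    proof -
      have "e \<notin> ind E A" "e \<notin> ind E B"
        using assms(2) A(2) B(2) \<open>x \<notin> B\<close> \<open>y \<notin> A\<close> by (simp_all add: ind_def)
      then show ?thesis using NK aK assms(1) by blast
    qed
    \<comment> \<open>This swap can raise degrees only at \<open>x\<close> and \<open>y\<close>,
      where there is room, and it lowers the degree at \<open>v\<close>, which is neither of
      them.\<close>
    define N' where "N' = insert e (N - {f})"
    have bN': "basis m N'" unfolding N'_def
      by (rule basis_exchange[OF bN eN assms(2) f(1)]) (rule min)
    have "f \<in> ind E D" "e \<in> ind E D"
      using f(1) QD NE eD eN unfolding ind_def by auto
    then have "N' - ind E D = N - ind E D" unfolding N'_def by blast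
    then have aN': "N' - ind E D = F - ind E D" using agree[OF AD BD] by simp
    have fN: "f \<in> N" using f(1) unfolding ind_def by simp
    have finN: "finite {g \<in> N. w \<in> \<delta> g}" for w using finite_edges[OF NE] by simp
    have rem: "deg (N - {f}) w \<le> deg N w" for w
      unfolding deg_def using finN by (intro card_mono) auto
    have ins: "deg N' w \<le> deg (N - {f}) w + (if w \<in> \<delta> e then 1 else 0)" for w
      unfolding N'_def using deg_insert_le[of "N - {f}"] NE by blast
    have "deg N' w \<le> cap w" if w: "w \<in> X" for w
    proof (cases "w \<in> \<delta> e")
      case True
      then have "deg N w < cap w" using dx dy w assms(2) by auto
      then show ?thesis using ins[of w] rem[of w] True by simp
    next
      case False
      then show ?thesis using ins[of w] rem[of w] dN[OF w] by simp
    qed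
    moreover have "M \<subseteq> N'" using M_sub_N f(3) unfolding N'_def by blast
    ultimately have "relief D N'" unfolding relief_def using bN' aN' by blast
    moreover have "D = comp m F ?S' v"
      using comp_eq[OF sp xy'(1), of v] v(1) QD unfolding D_def by blast
    ultimately have "cap v \<le> deg N' v" using v(2) vS' by (auto simp: blocked.simps(2))
    moreover have "{g \<in> N - {f}. v \<in> \<delta> g} = {g \<in> N. v \<in> \<delta> g} - {f}" by blast
    then have "deg (N - {f}) v < deg N v"
      unfolding deg_def using finN fN f(2) card_Diff1_less[of "{g \<in> N. v \<in> \<delta> g}" f] by simp
    moreover have "v \<notin> \<delta> e" using vxy assms(2) by simp
    ultimately show False using ins[of v] dN[OF vX] by simp
  qed
qed

text \<open>The stages grow inside the finite set \<open>X\<close>. Asking for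
  \<open>n \<ge> 1\<close> ensures that the stable stage contains all vertices with excess, by
  \<open>excess_blocked\<close>.\<close>

lemma blocked_stable:
  obtains n where "blocked (Suc n) = blocked n" "n \<ge> 1"
proof -
  have fin: "finite (blocked n)" for n
    using finite_sub blocked_subset X by (meson order_trans)
  have "\<exists>n\<ge>1. blocked (Suc n) = blocked n"
  proof (rule ccontr)
    assume no: "\<not> ?thesis"
    \<comment> \<open>Strict growth is available only from stage 1 on, whence the shift by
      one.\<close>
    have "n \<le> card (blocked (Suc n))" for n
    proof (induction n)
      case (Suc n)
      have "blocked (Suc n) \<subset> blocked (Suc (Suc n))" 
        using no blocked_mono[of "Suc n"] by (metis le_add1 plus_1_eq_Suc psubsetI)
      then have "card (blocked (Suc n)) < card (blocked (Suc (Suc n)))"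
        using fin by (intro psubset_card_mono)
      then show ?case using Suc.IH by simp
    qed simp
    moreover have "card (blocked k) \<le> card V" for k
      using blocked_subset X finV by (meson card_mono order_trans)
    ultimately have "card V + 1 \<le> card V" using le_trans by blast
    then show False by simp
  qed
  then show ?thesis using that by blast
qed

text \<open>\<open>S\<close> is the stable stage of \<open>blocked\<close>. As stages
  \<open>n\<close> and \<open>Suc n\<close> coincide, \<open>blocked_edge\<close> says of
  \<open>S\<close> itself that no edge outside \<open>F\<close> joins two components; every degree
  in \<open>S\<close> reaches its bound by \<open>blocked_deg\<close>, and one exceeds it.\<close>

lemma excess_obstruction:
  assumes "excess X b F > 0"
  obtains S where "S \<subseteq> X" "S \<noteq> {}" "(\<Sum>v\<in>S. b v) < (\<Sum>v\<in>S. deg F v)"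
    "crossing (ind E (V - S)) (comp m F S) \<subseteq> F"
proof -
  obtain n where n: "blocked (Suc n) = blocked n" "n \<ge> 1" by (rule blocked_stable)
  let ?S = "blocked n"
  have fin: "finite ?S" using finite_sub blocked_subset X by (meson order_trans)
  have "\<exists>v\<in>X. b v < deg F v"
  proof (rule ccontr)
    assume "\<not> ?thesis"
    then have "excess X b F = 0" unfolding excess_def by (intro sum.neutral) (simp add: not_less)
    then show False using assms by simp
  qed
  then obtain v where v: "v \<in> X" "b v < deg F v" by blast
  have "blocked 1 \<subseteq> ?S" using n(2)
  proof (induction n rule: dec_induct)
    case (step k)
    then show ?case using blocked_mono by blast
  qed simp
  then have vS: "v \<in> ?S" using excess_blocked[OF v] by blast
  have "(\<Sum>v\<in>?S. b v) < (\<Sum>v\<in>?S. deg F v)"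
    using fin blocked_deg v(2) vS by (intro sum_strict_mono_ex1) auto
  moreover have "crossing (ind E (V - ?S)) (comp m F ?S) \<subseteq> F"
  proof
    fix e assume e: "e \<in> crossing (ind E (V - ?S)) (comp m F ?S)"
    then have eE: "e \<in> E" and sub: "\<delta> e \<subseteq> V - ?S" unfolding crossing_def ind_def by blast+
    obtain x y where xy: "\<delta> e = {x, y}" using eE by (rule ends_obtain)
    have "comp m F ?S x \<noteq> comp m F ?S y" using e unfolding crossing_def by (auto simp: xy)
    then show "e \<in> F" using blocked_edge[of e x y n] eE xy sub n(1) by auto
  qed
  ultimately show ?thesis using that blocked_subset vS by blast
qed

end

subsection \<open>Degree sums and cuts\<close>

lemma deg_sum_ends:
  assumes "F \<subseteq> E" "S \<subseteq> V"
  shows "(\<Sum>v\<in>S. deg F v) = (\<Sum>e\<in>F. card (\<delta> e \<inter> S))"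
proof -
  have finF: "finite F" and finS: "finite S" using assms finite_edges finite_sub by blast+
  have "(\<Sum>v\<in>S. deg F v) = (\<Sum>v\<in>S. \<Sum>e\<in>F. if v \<in> \<delta> e then 1 else 0)"
    unfolding deg_def using finF by (simp add: sum.If_cases Int_def)
  also have "\<dots> = (\<Sum>e\<in>F. \<Sum>v\<in>S. if v \<in> \<delta> e then 1 else 0)" by (rule sum.swap)
  also have "\<dots> = (\<Sum>e\<in>F. card (\<delta> e \<inter> S))"
    using finS by (simp add: sum.If_cases Int_def conj_commute)
  finally show ?thesis .
qed

lemma card_filter_sum: "finite F \<Longrightarrow> card {e \<in> F. P e} = (\<Sum>e\<in>F. if P e then 1 else 0)"
  by (simp add: sum.If_cases Int_def)

lemma deg_sum:
  assumes "F \<subseteq> E" "S \<subseteq> V"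
  shows "(\<Sum>v\<in>S. deg F v) = card {e \<in> F. \<delta> e \<inter> S \<noteq> {}} + card (ind F S)"
proof -
  have finF: "finite F" using assms finite_edges by blast
  have "card (\<delta> e \<inter> S) = (if \<delta> e \<inter> S \<noteq> {} then 1 else 0) + (if \<delta> e \<subseteq> S then 1 else 0)"
    if e: "e \<in> F" for e
  proof -
    have "e \<in> E" using e assms(1) by blast
    then obtain x y where "\<delta> e = {x, y}" "x \<noteq> y" by (rule ends_obtain)
    then show ?thesis by (cases "x \<in> S"; cases "y \<in> S") (simp_all add: Int_insert_left)
  qed
  then show ?thesis
    unfolding deg_sum_ends[OF assms] ind_def card_filter_sum[OF finF] by (simp add: sum.distrib)
qed

text \<open>A single vertex spans no edge, as there are no loops. Otherwise the degree sum counts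
  each spanned edge twice, so at most \<open>m / 2\<close> edges per vertex are spanned, which
  suffices from \<open>card Q = 2\<close> on.\<close>

lemma sparse_if_deg:
  assumes "M \<subseteq> E" "\<And>v. v \<in> V \<Longrightarrow> deg M v \<le> m"
  shows "sparse m M"
  unfolding sparse_def
proof (intro conjI allI impI)
  fix Q assume Q: "Q \<subseteq> V \<and> Q \<noteq> {}"
  then have "card Q \<noteq> 0" using finite_sub by auto
  then consider "card Q = 1" | "card Q \<ge> 2" by linarith
  then show "card (ind M Q) + m \<le> m * card Q"
  proof cases
    case 1
    then obtain v where "Q = {v}" by (rule card_1_singletonE)
    then show ?thesis using tight_card[OF tight_singleton[OF assms(1), of v]] Q by simp
  next
    case 2
    have "finite M" using assms(1) finite_edges by blast
    then have "card (ind M Q) \<le> card {e \<in> M. \<delta> e \<inter> Q \<noteq> {}}"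
      using ends_nonempty assms(1) by (intro card_mono) (auto simp: ind_def)
    then have "2 * card (ind M Q) \<le> (\<Sum>v\<in>Q. deg M v)" using deg_sum[OF assms(1)] Q by simp
    also have "\<dots> \<le> (\<Sum>v\<in>Q. m)" using assms(2) Q by (intro sum_mono) blast
    also have "\<dots> = m * card Q" by simp
    finally show ?thesis using mult_le_mono2[OF 2, of m] by linarith
  qed
qed (rule assms(1))

text \<open>\<open>cond\<close> excludes every obstruction. If \<open>S\<close> comes from
  \<open>excess_obstruction\<close>, with t components outside \<open>S\<close> and x edges of
  \<open>F\<close> between them, then \<open>edge_split\<close> and \<open>basis_card\<close> make
  the degree sum of \<open>F\<close> over \<open>S\<close> equal to m (card S + t) + card (ind F S)
  - x - m, which \<open>cond\<close> bounds by the sum of \<open>b\<close>.\<close>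

lemma bounded_basis:
  fixes b :: "'v \<Rightarrow> nat"
  assumes M: "M \<subseteq> E" "\<And>v. v \<in> V \<Longrightarrow> deg M v \<le> m" and X: "X \<subseteq> V"
    and F0: "basis m F0" "M \<subseteq> F0"
    and cond: "\<And>S F (p :: 'v \<Rightarrow> 'v set). S \<subseteq> X \<Longrightarrow> S \<noteq> {} \<Longrightarrow> basis m F \<Longrightarrow>
      m * (card S + card (p ` (V - S))) + card (ind F S)
        \<le> (\<Sum>v\<in>S. b v) + card (crossing (ind E (V - S)) p) + m"
  obtains F where "basis m F" "M \<subseteq> F" "\<And>v. v \<in> X \<Longrightarrow> deg F v \<le> b v"
proof -
  obtain F where F: "basis m F" "M \<subseteq> F"
    and min: "\<And>K. basis m K \<Longrightarrow> M \<subseteq> K \<Longrightarrow> excess X b F \<le> excess X b K"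
    using ex_has_least_nat[of "\<lambda>K. basis m K \<and> M \<subseteq> K" F0 "excess X b"] F0 by blast
  have "excess X b F = 0"
  proof (rule ccontr)
    assume "excess X b F \<noteq> 0"
    then obtain S where S: "S \<subseteq> X" "S \<noteq> {}" "(\<Sum>v\<in>S. b v) < (\<Sum>v\<in>S. deg F v)"
        and sub: "crossing (ind E (V - S)) (comp m F S) \<subseteq> F"
      using excess_obstruction[OF M X F min] by blast
    note FE = basis_subset[OF F(1)]
    have SV: "S \<subseteq> V" using S(1) X by blast
    have "crossing (ind E (V - S)) (comp m F S) \<subseteq> crossing (ind F (V - S)) (comp m F S)"
      using sub unfolding crossing_def ind_def by blast
    moreover have "finite (crossing (ind F (V - S)) (comp m F S))"
      using finite_ind[OF FE] unfolding crossing_def by simp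
    ultimately have "card (crossing (ind E (V - S)) (comp m F S))
        \<le> card (crossing (ind F (V - S)) (comp m F S))"
      by (intro card_mono)
    moreover have "card V = card (V - S) + card S"
      using SV finV card_mono[OF finV SV] by (simp add: card_Diff_subset finite_sub)
    then have "m * card V = m * card (V - S) + m * card S" by (simp add: distrib_left)
    moreover have "m * (card S + card (comp m F S ` (V - S)))
        = m * card S + m * card (comp m F S ` (V - S))" by (rule distrib_left)
    moreover note edge_split[OF basis_sparse[OF F(1)] SV] basis_card[OF F(1)] S(3)
      deg_sum[OF FE SV] cond[OF S(1,2) F(1), of "comp m F S"]
    ultimately show False by linarith
  qed
  then have "deg F v \<le> b v" if "v \<in> X" for v
    using that finite_sub[OF X] unfolding excess_def by simp
  then show ?thesis using that F by blast
qed

text \<open>The easy direction of the tree packing theorem: \<open>crossing_bound\<close> applies to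
  each tree separately, and disjoint trees cross in different edges.\<close>

lemma trees_crossing:
  assumes "\<And>i. i < k \<Longrightarrow> T i \<subseteq> E"
    and "\<And>i x y. i < k \<Longrightarrow> x \<in> V \<Longrightarrow> y \<in> V \<Longrightarrow> (x, y) \<in> conn (T i)"
    and "\<And>i j. i < k \<Longrightarrow> j < k \<Longrightarrow> i \<noteq> j \<Longrightarrow> T i \<inter> T j = {}"
  shows "k * card (q ` V) \<le> card (crossing E q) + k"
proof -
  have fin: "finite (crossing (T i) q)" if "i < k" for i
    using finite_edges[OF assms(1)[OF that]] unfolding crossing_def by simp
  have "k * card (q ` V) = (\<Sum>i<k. card (q ` V))" by simp
  also have "\<dots> \<le> (\<Sum>i<k. card (crossing (T i) q) + 1)"
  proof (rule sum_mono)
    fix i assume "i \<in> {..<k}"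
    then have i: "i < k" by simp
    show "card (q ` V) \<le> card (crossing (T i) q) + 1"
      using assms(1)[OF i] ends_sub
      by (intro crossing_bound[OF assms(1)[OF i] finV neV _ assms(2)[OF i]]) blast+
  qed
  also have "\<dots> = (\<Sum>i<k. card (crossing (T i) q)) + k" by (simp only: sum.distrib) simp
  also have "(\<Sum>i<k. card (crossing (T i) q)) = card (\<Union>i<k. crossing (T i) q)"
  proof (rule card_UN_disjoint[symmetric])
    show "\<forall>i\<in>{..<k}. \<forall>j\<in>{..<k}. i \<noteq> j \<longrightarrow> crossing (T i) q \<inter> crossing (T j) q = {}"
    proof (intro ballI impI)
      fix i j assume "i \<in> {..<k}" "j \<in> {..<k}" "i \<noteq> j"
      then have "T i \<inter> T j = {}" using assms(3) by simp
      then show "crossing (T i) q \<inter> crossing (T j) q = {}" unfolding crossing_def by blast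
    qed
  qed (use fin in simp_all)
  also have "(\<Union>i<k. crossing (T i) q) \<subseteq> crossing E q"
    using assms(1) unfolding crossing_def by blast
  then have "card (\<Union>i<k. crossing (T i) q) \<le> card (crossing E q)"
    using finE by (intro card_mono) (simp_all add: crossing_def)
  finally show ?thesis by simp
qed

text \<open>The cut bound is applied to the partition into singletons of \<open>S\<close> and
  classes of \<open>p\<close>; the sum type keeps the two kinds of labels apart. A crossing edge
  meets \<open>S\<close> or crosses \<open>p\<close>, and the degree sum counts the edges inside
  \<open>S\<close> a second time.\<close>

lemma crossing_split:
  fixes p :: "'v \<Rightarrow> 'l"
  assumes cut: "\<And>q :: 'v \<Rightarrow> 'v + 'l. k * card (q ` V) \<le> card (crossing E q) + k"
    and "S \<subseteq> V"
  shows "k * (card S + card (p ` (V - S))) + card (ind E S)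
    \<le> (\<Sum>v\<in>S. deg E v) + card (crossing (ind E (V - S)) p) + k"
proof -
  define q where "q v = (if v \<in> S then Inl v else Inr (p v))" for v
  have "q ` V = Inl ` S \<union> Inr ` p ` (V - S)"
    using assms(2) by (auto simp: q_def image_iff)
  moreover have "Inl ` S \<inter> Inr ` p ` (V - S) = {}" by auto
  ultimately have card_q: "card (q ` V) = card S + card (p ` (V - S))"
    using finite_sub[OF assms(2)] finV by (simp add: card_Un_disjoint card_image)
  moreover have "crossing E q \<subseteq> {e \<in> E. \<delta> e \<inter> S \<noteq> {}} \<union> crossing (ind E (V - S)) p"
  proof
    fix e assume e: "e \<in> crossing E q"
    then have eE: "e \<in> E" unfolding crossing_def by simp
    show "e \<in> {e \<in> E. \<delta> e \<inter> S \<noteq> {}} \<union> crossing (ind E (V - S)) p"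
    proof (cases "\<delta> e \<inter> S = {}")
      case True
      then have sub: "\<delta> e \<subseteq> V - S" using ends_sub[OF eE] by blast
      obtain x y where xy: "x \<in> \<delta> e" "y \<in> \<delta> e" "q x \<noteq> q y"
        using e unfolding crossing_def by blast
      then have "x \<notin> S" "y \<notin> S" using True by blast+
      then have "p x \<noteq> p y" using xy(3) by (auto simp: q_def)
      then have "e \<in> crossing (ind E (V - S)) p"
        using xy(1,2) eE sub unfolding crossing_def ind_def by blast
      then show ?thesis by (rule UnI2)
    qed (use eE in blast)
  qed
  moreover have "finite (crossing (ind E (V - S)) p)"
    using finE by (simp add: crossing_def ind_def)
  moreover have "finite {e \<in> E. \<delta> e \<inter> S \<noteq> {}}" using finE by simp
  ultimately have "card (crossing E q)
      \<le> card ({e \<in> E. \<delta> e \<inter> S \<noteq> {}} \<union> crossing (ind E (V - S)) p)"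
    by (intro card_mono finite_UnI)
  also have "\<dots> \<le> card {e \<in> E. \<delta> e \<inter> S \<noteq> {}} + card (crossing (ind E (V - S)) p)"
    by (rule card_Un_le)
  finally have "card (crossing E q)
      \<le> card {e \<in> E. \<delta> e \<inter> S \<noteq> {}} + card (crossing (ind E (V - S)) p)" .
  then show ?thesis
    using cut[of q] card_q deg_sum[OF order_refl assms(2)] by simp
qed

text \<open>Adds up the boundaries of all classes of \<open>p\<close>, each of size at least
  \<open>k\<close>. An edge between two classes is counted twice and an edge from a class to
  \<open>S\<close> once, while edges inside \<open>S\<close> occur only in the degree sum,
  twice.\<close>

lemma boundary_split:
  fixes p :: "'v \<Rightarrow> 'l"
  assumes cut: "\<And>Q. Q \<subset> V \<Longrightarrow> Q \<noteq> {} \<Longrightarrow> k \<le> card {e \<in> E. \<delta> e \<inter> Q \<noteq> {} \<and> \<not> \<delta> e \<subseteq> Q}"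
    and "S \<subseteq> V" "S \<noteq> {} \<or> card (p ` (V - S)) \<ge> 2"
  shows "k * card (p ` (V - S)) + 2 * card (ind E S)
    \<le> (\<Sum>v\<in>S. deg E v) + 2 * card (crossing (ind E (V - S)) p)"
proof -
  let ?P = "p ` (V - S)"
  define Q where "Q l = {v \<in> V - S. p v = l}" for l
  define bd where "bd l e \<longleftrightarrow> \<delta> e \<inter> Q l \<noteq> {} \<and> \<not> \<delta> e \<subseteq> Q l" for l e
  have finP: "finite ?P" using finV by simp
  have k: "k \<le> card {e \<in> E. bd l e}" if l: "l \<in> ?P" for l
  proof -
    have "Q l \<noteq> {}" using l unfolding Q_def by blast
    \<comment> \<open>The third hypothesis enters here: a class must not be all of \<open>V\<close>,
      whose boundary is empty.\<close>
    moreover have "Q l \<noteq> V"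
    proof
      assume V: "Q l = V"
      then have "S = {}" using assms(2) unfolding Q_def by blast
      moreover have "?P \<subseteq> {l}" using V unfolding Q_def by blast
      then have "card ?P \<le> 1" using card_mono[of "{l}" ?P] by simp
      ultimately show False using assms(3) by simp
    qed
    moreover have "Q l \<subseteq> V" unfolding Q_def by blast
    ultimately show ?thesis unfolding bd_def by (intro cut) blast+
  qed
  \<comment> \<open>After exchanging the order of summation, the claim reduces to this inequality
    for each edge.\<close>
  have edge: "card {l \<in> ?P. bd l e} + 2 * (if \<delta> e \<subseteq> S then 1 else 0)
      \<le> card (\<delta> e \<inter> S) + 2 * (if e \<in> crossing (ind E (V - S)) p then 1 else 0)"
    if e: "e \<in> E" for e
  proof -
    obtain x y where xy: "\<delta> e = {x, y}" "x \<noteq> y" "x \<in> V" "y \<in> V" using e by (rule ends_obtain)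
    have sub: "{l \<in> ?P. bd l e} \<subseteq> p ` (\<delta> e - S)"
    proof
      fix l assume "l \<in> {l \<in> ?P. bd l e}"
      then obtain v where "v \<in> \<delta> e" "v \<in> Q l" unfolding bd_def by blast
      then show "l \<in> p ` (\<delta> e - S)" unfolding Q_def by auto
    qed
    have fin: "finite (\<delta> e - S)" using xy(1) by simp
    have "card {l \<in> ?P. bd l e} \<le> card (p ` (\<delta> e - S))" using sub fin by (intro card_mono) simp_all
    also have "\<dots> \<le> card (\<delta> e - S)" using fin by (rule card_image_le)
    finally have le: "card {l \<in> ?P. bd l e} \<le> card (\<delta> e - S)" .
    have "card (\<delta> e - S) + card (\<delta> e \<inter> S) = 2"
      using card_Int_Diff[of "\<delta> e" S] ends_card[OF e] xy(1) by simp
    show ?thesis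
    proof (cases "x \<in> S \<or> y \<in> S")
      case True
      then show ?thesis using le xy(1,2)
        by (cases "x \<in> S"; cases "y \<in> S") (simp_all add: insert_Diff_if Int_insert_left)
    next
      case False
      then have eV: "e \<in> ind E (V - S)" using e xy unfolding ind_def by simp
      show ?thesis
      proof (cases "p x = p y")
        case True
        have "\<not> bd l e" for l
          using True False xy(3,4) unfolding bd_def Q_def xy(1) by auto
        then show ?thesis using False xy(1) by simp
      next
        case neq: False
        then have "e \<in> crossing (ind E (V - S)) p" using eV by (auto simp: crossing_def xy(1))
        moreover have "card (\<delta> e - S) \<le> 2" using \<open>_ = 2\<close> by linarith
        ultimately show ?thesis using le False xy(1) by simp
      qed
    qed
  qed
  have "k * card ?P = (\<Sum>l\<in>?P. k)" by simp
  also have "\<dots> \<le> (\<Sum>l\<in>?P. card {e \<in> E. bd l e})" using k by (rule sum_mono)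
  also have "\<dots> = (\<Sum>e\<in>E. card {l \<in> ?P. bd l e})"
    unfolding card_filter_sum[OF finE] card_filter_sum[OF finP] by (rule sum.swap)
  finally have 1: "k * card ?P \<le> (\<Sum>e\<in>E. card {l \<in> ?P. bd l e})" .
  have "card (crossing (ind E (V - S)) p) = card {e \<in> E. e \<in> crossing (ind E (V - S)) p}"
    by (intro arg_cong[of _ _ card]) (auto simp: crossing_def ind_def)
  then have 2: "card (crossing (ind E (V - S)) p) =
      (\<Sum>e\<in>E. if e \<in> crossing (ind E (V - S)) p then 1 else 0)"
    using card_filter_sum[OF finE] by simp
  have 3: "card (ind E S) = (\<Sum>e\<in>E. if \<delta> e \<subseteq> S then 1 else 0)"
    unfolding ind_def by (rule card_filter_sum[OF finE])
  have "(\<Sum>e\<in>E. card {l \<in> ?P. bd l e}) + 2 * card (ind E S)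
      = (\<Sum>e\<in>E. card {l \<in> ?P. bd l e} + 2 * (if \<delta> e \<subseteq> S then 1 else 0))"
    unfolding 3 sum_distrib_left by (rule sum.distrib[symmetric])
  also have "\<dots> \<le> (\<Sum>e\<in>E. card (\<delta> e \<inter> S) + 2 * (if e \<in> crossing (ind E (V - S)) p then 1 else 0))"
    using edge by (rule sum_mono)
  also have "\<dots> = (\<Sum>v\<in>S. deg E v) + 2 * card (crossing (ind E (V - S)) p)"
    unfolding 2 deg_sum_ends[OF order_refl assms(2)] sum_distrib_left by (rule sum.distrib)
  finally show ?thesis using 1 by linarith
qed

text \<open>
  Rounding up at all vertices of \<open>S\<close> and down at \<open>u\<close> loses less than one in total, which
  integrality recovers: this is why the right-hand side only needs \<open>c * (card S - 1)\<close>.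
\<close>

lemma rounded_basis:
  fixes m k :: nat and c :: real
  assumes M: "M \<subseteq> E" "\<And>v. v \<in> V \<Longrightarrow> deg M v \<le> m" and X: "X \<subseteq> V" and u: "u \<in> X"
    and F0: "basis m F0" "M \<subseteq> F0" and c: "c \<ge> 0"
    and cond: "\<And>S F (p :: 'v \<Rightarrow> 'v set). S \<subseteq> X \<Longrightarrow> S \<noteq> {} \<Longrightarrow> basis m F \<Longrightarrow>
      m * (card S + card (p ` (V - S))) + card (ind F S)
        \<le> m / k * (\<Sum>v\<in>S. deg E v) + c * (real (card S) - 1)
          + card (crossing (ind E (V - S)) p) + m"
  obtains F where "basis m F" "M \<subseteq> F" "\<And>v. v \<in> X \<Longrightarrow> int (deg F v) \<le> \<lceil>m / k * deg E v + c\<rceil>"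
    "int (deg F u) \<le> \<lfloor>m / k * deg E u\<rfloor>"
proof -
  let ?r = "real m / real k"
  define b where "b v = nat (if v = u then \<lfloor>?r * deg E v\<rfloor> else \<lceil>?r * deg E v + c\<rceil>)" for v
  have nonneg: "0 \<le> ?r * deg E v" for v by simp
  have ceil0: "0 \<le> \<lceil>?r * deg E v + c\<rceil>" for v
    using nonneg[of v] c by linarith
  have bv: "real (b v) \<ge> ?r * deg E v + c" if "v \<noteq> u" for v
    using ceil0[of v] that unfolding b_def by simp
  have bu: "real (b u) > ?r * deg E u - 1"
    using nonneg[of u] unfolding b_def by simp
  have "m * (card S + card (p ` (V - S))) + card (ind F S)
        \<le> (\<Sum>v\<in>S. b v) + card (crossing (ind E (V - S)) p) + m"
    if S: "S \<subseteq> X" "S \<noteq> {}" "basis m F" for S F and p :: "'v \<Rightarrow> 'v set"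
  proof -
    have finS: "finite S" using finite_sub S(1) X by (meson order_trans)
    have sum: "(\<Sum>v\<in>A. ?r * deg E v + c) = ?r * (\<Sum>v\<in>A. deg E v) + c * card A" for A
      by (simp add: sum.distrib sum_distrib_left)
    have le: "(\<Sum>v\<in>A. ?r * deg E v + c) \<le> (\<Sum>v\<in>A. b v)" if "u \<notin> A" for A
      unfolding of_nat_sum using that bv by (intro sum_mono) metis
    have "?r * (\<Sum>v\<in>S. deg E v) + c * (real (card S) - 1) - 1 < (\<Sum>v\<in>S. b v)"
    proof (cases "u \<in> S")
      case True
      let ?A = "S - {u}"
      have "card S = card ?A + 1" using card.remove[OF finS True] by simp
      moreover have "(\<Sum>v\<in>S. b v) = b u + (\<Sum>v\<in>?A. b v)"
          "(\<Sum>v\<in>S. deg E v) = deg E u + (\<Sum>v\<in>?A. deg E v)"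
        using sum.remove[OF finS True] by blast+
      ultimately show ?thesis using le[of ?A] bu unfolding sum by (simp add: algebra_simps)
    next
      case False
      then show ?thesis using le[of S] c unfolding sum by (simp add: algebra_simps)
    qed
    then have "real (m * (card S + card (p ` (V - S))) + card (ind F S))
        < real ((\<Sum>v\<in>S. b v) + card (crossing (ind E (V - S)) p) + m + 1)"
      using cond[OF S, of p] by simp
    then show ?thesis unfolding of_nat_less_iff by linarith
  qed
  then obtain F where F: "basis m F" "M \<subseteq> F" "\<And>v. v \<in> X \<Longrightarrow> deg F v \<le> b v"
    using bounded_basis[OF M X F0, of b] by blast
  have u_le: "int (deg F u) \<le> \<lfloor>?r * deg E u\<rfloor>"
    using F(3)[OF u] nonneg[of u] unfolding b_def by (simp add: le_nat_iff)
  have "int (deg F v) \<le> \<lceil>?r * deg E v + c\<rceil>" if v: "v \<in> X" for v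
  proof (cases "v = u")
    case True
    have "real (deg F u) \<le> ?r * deg E u" using u_le by (simp add: le_floor_iff)
    then have "real (deg F u) \<le> ?r * deg E u + c" using c by linarith
    then show ?thesis unfolding True by linarith
  next
    case False
    then show ?thesis using F(3)[OF v] ceil0[of v] unfolding b_def by (simp add: le_nat_iff)
  qed
  then show ?thesis using that F(1,2) u_le by blast
qed

section \<open>The counting condition for spanning trees and for edge-connectivity\<close>

lemma ind_independent:
  assumes "\<And>e. e \<in> E \<Longrightarrow> \<not> \<delta> e \<subseteq> X" "S \<subseteq> X" "F \<subseteq> E"
  shows "ind F S = {}"
  using assms unfolding ind_def by blast

lemma basis_ind_bounds:
  assumes "basis m F" "S \<subseteq> V" "S \<noteq> {}"
  shows "card (ind F S) \<le> card (ind E S)" "real (card (ind F S)) \<le> m * (real (card S) - 1)"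
proof -
  show "card (ind F S) \<le> card (ind E S)"
    using basis_subset[OF assms(1)] finite_ind[OF order_refl]
    by (intro card_mono) (auto simp: ind_def)
  have "real (card (ind F S) + m) \<le> real (m * card S)"
    using sparse_le[OF basis_sparse[OF assms(1)] assms(2,3)] unfolding of_nat_le_iff .
  then show "real (card (ind F S)) \<le> m * (real (card S) - 1)"
    by (simp add: algebra_simps)
qed

text \<open>Combines both bounds on \<open>i\<close> with weights \<open>r\<close> and
  \<open>1 - r\<close>. With \<open>i\<close> and \<open>j\<close> the numbers of edges of
  \<open>F\<close> and of \<open>E\<close> inside \<open>S\<close>, this is the source of the
  constants \<open>c\<close> when \<open>X\<close> need not be independent.\<close>

lemma slack_bound:
  fixes i j m r :: real
  assumes "i \<le> j" "i \<le> m * s" "0 \<le> r" "r \<le> 1"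
  shows "i \<le> r * j + m * (1 - r) * s"
proof -
  have "(1 - r) * i \<le> (1 - r) * (m * s)" "r * i \<le> r * j"
    using assms by (intro mult_left_mono; simp)+
  then show ?thesis by (simp add: algebra_simps)
qed

text \<open>\<open>crossing_split\<close> is scaled by \<open>m / k\<close>. It remains to pay for
  the edges of \<open>F\<close> inside \<open>S\<close> beyond the \<open>m / k\<close> share of
  those of \<open>E\<close>: none if \<open>X\<close> is independent, otherwise at most
  \<open>m * (1 - m / k)\<close> times \<open>card S - 1\<close> by
  \<open>slack_bound\<close>.\<close>

lemma tree_case:
  fixes m k :: nat and p :: "'v \<Rightarrow> 'l"
  assumes mk: "1 \<le> m" "m \<le> k"
    and cut: "\<And>q :: 'v \<Rightarrow> 'v + 'l. k * card (q ` V) \<le> card (crossing E q) + k"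
    and S: "S \<subseteq> X" "X \<subseteq> V" "S \<noteq> {}" and F: "basis m F"
    and c: "c = real m * (1 - real m / real k) \<or> c = 0 \<and> (\<forall>e\<in>E. \<not> \<delta> e \<subseteq> X)"
  shows "m * (card S + card (p ` (V - S))) + card (ind F S)
    \<le> m / k * (\<Sum>v\<in>S. deg E v) + c * (real (card S) - 1)
      + card (crossing (ind E (V - S)) p) + m"
proof -
  let ?r = "real m / real k" and ?n = "real (card S + card (p ` (V - S)))"
    and ?x = "real (card (crossing (ind E (V - S)) p))" and ?d = "real (\<Sum>v\<in>S. deg E v)"
  have SV: "S \<subseteq> V" using S by blast
  have r: "0 \<le> ?r" "?r \<le> 1" "?r * k = m" using mk by auto
  have "real (k * (card S + card (p ` (V - S))) + card (ind E S))
      \<le> real ((\<Sum>v\<in>S. deg E v) + card (crossing (ind E (V - S)) p) + k)"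
    using crossing_split[OF cut SV, of p] unfolding of_nat_le_iff .
  then have "k * ?n + card (ind E S) \<le> ?d + ?x + k" by simp
  then have "?r * (k * ?n + card (ind E S)) \<le> ?r * (?d + ?x + k)"
    using r(1) by (rule mult_left_mono)
  then have "?r * k * ?n + ?r * card (ind E S) \<le> ?r * ?d + ?r * ?x + ?r * k"
    by (simp only: distrib_left mult.assoc)
  then have 1: "m * ?n + ?r * card (ind E S) \<le> ?r * ?d + ?r * ?x + m" unfolding r(3) .
  have 2: "?r * ?x \<le> 1 * ?x" using r(2) by (intro mult_right_mono) simp_all
  have "card (ind F S) \<le> ?r * card (ind E S) + c * (real (card S) - 1)"
  proof (cases "c = real m * (1 - ?r)")
    case True
    then show ?thesis
      using slack_bound[OF _ basis_ind_bounds(2)[OF F SV S(3)] r(1,2)]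
        basis_ind_bounds(1)[OF F SV S(3)] by simp
  next
    case False
    then have "c = 0" "\<And>e. e \<in> E \<Longrightarrow> \<not> \<delta> e \<subseteq> X" using c by auto
    then show ?thesis using ind_independent[OF _ S(1) basis_subset[OF F]] by simp
  qed
  then show ?thesis using 1 2 by simp
qed

text \<open>\<open>boundary_split\<close> is scaled by \<open>m / k\<close>; crossing edges count
  twice in it, and \<open>2 * m \<le> k\<close> keeps their weight at most one. Unlike the tree
  bound it yields nothing for the vertices of \<open>S\<close>, so \<open>c\<close> has to pay a
  further \<open>m\<close> for each but one: \<open>m + m * (1 - 2 * m / k)\<close> is
  \<open>2 * m * (1 - m / k)\<close>, and only \<open>m\<close> remains for independent
  \<open>X\<close>.\<close>

lemma edge_case:
  fixes m k :: nat and c :: real and p :: "'v \<Rightarrow> 'l"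
  assumes mk: "1 \<le> m" "2 * m \<le> k"
    and cut: "\<And>Q. Q \<subset> V \<Longrightarrow> Q \<noteq> {} \<Longrightarrow> k \<le> card {e \<in> E. \<delta> e \<inter> Q \<noteq> {} \<and> \<not> \<delta> e \<subseteq> Q}"
    and S: "S \<subseteq> X" "X \<subseteq> V" "S \<noteq> {}" and F: "basis m F"
    and c: "c = 2 * real m * (1 - real m / real k) \<or> c = real m \<and> (\<forall>e\<in>E. \<not> \<delta> e \<subseteq> X)"
  shows "m * (card S + card (p ` (V - S))) + card (ind F S)
    \<le> m / k * (\<Sum>v\<in>S. deg E v) + c * (real (card S) - 1)
      + card (crossing (ind E (V - S)) p) + m"
proof -
  let ?r = "real m / real k" and ?n = "real (card (p ` (V - S)))"
    and ?x = "real (card (crossing (ind E (V - S)) p))" and ?d = "real (\<Sum>v\<in>S. deg E v)"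
  have SV: "S \<subseteq> V" using S by blast
  have r: "0 \<le> 2 * ?r" "2 * ?r \<le> 1" "?r * k = m" using mk by (auto simp: field_simps)
  have "real (k * card (p ` (V - S)) + 2 * card (ind E S))
      \<le> real ((\<Sum>v\<in>S. deg E v) + 2 * card (crossing (ind E (V - S)) p))"
    using boundary_split[OF cut SV, of p] S(3) unfolding of_nat_le_iff by blast
  then have "k * ?n + 2 * card (ind E S) \<le> ?d + 2 * ?x" by simp
  then have "?r * (k * ?n + 2 * card (ind E S)) \<le> ?r * (?d + 2 * ?x)"
    by (rule mult_left_mono) simp
  then have "?r * k * ?n + 2 * ?r * card (ind E S) \<le> ?r * ?d + 2 * ?r * ?x"
    by (simp only: distrib_left mult.assoc mult.left_commute of_nat_mult of_nat_numeral)
  then have 1: "m * ?n + 2 * ?r * card (ind E S) \<le> ?r * ?d + 2 * ?r * ?x" unfolding r(3) .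
  have 2: "2 * ?r * ?x \<le> 1 * ?x" using r(2) by (rule mult_right_mono) simp
  have "m * real (card S) + card (ind F S) \<le> 2 * ?r * card (ind E S) + c * (real (card S) - 1) + m"
  proof (cases "c = 2 * real m * (1 - ?r)")
    case True
    have "card (ind F S) \<le> 2 * ?r * card (ind E S) + m * (1 - 2 * ?r) * (real (card S) - 1)"
      using slack_bound[OF _ basis_ind_bounds(2)[OF F SV S(3)] r(1,2)]
        basis_ind_bounds(1)[OF F SV S(3)] by simp
    then show ?thesis unfolding True by (simp add: algebra_simps)
  next
    case False
    then have "c = m" "\<And>e. e \<in> E \<Longrightarrow> \<not> \<delta> e \<subseteq> X" using c by auto
    then show ?thesis using ind_independent[OF _ S(1) basis_subset[OF F]]
      by (simp add: algebra_simps)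
  qed
  then show ?thesis using 1 2 by (simp add: distrib_left)
qed

text \<open>Cancelling one class turns both bounds into multiples of the number of classes minus
  one, which is a natural number because \<open>V\<close> is nonempty.\<close>

lemma tree_cut_condition:
  fixes p :: "'v \<Rightarrow> 'l"
  assumes "m \<le> k" "k * card (p ` V) \<le> card (crossing E p) + k"
  shows "m * card (p ` V) \<le> card (crossing E p) + m"
proof -
  have "card (p ` V) \<noteq> 0" using finV neV by simp
  then obtain n where n: "card (p ` V) = Suc n" using not0_implies_Suc by blast
  have "m * n \<le> k * n" using assms(1) by simp
  then show ?thesis using assms(2) unfolding n mult_Suc_right by linarith
qed

text \<open>\<open>boundary_split\<close> with empty \<open>S\<close> counts each crossing edge
  twice, which \<open>2 * m \<le> k\<close> absorbs; a single class demands no edges.\<close>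

lemma edge_cut_condition:
  fixes p :: "'v \<Rightarrow> 'l"
  assumes "2 * m \<le> k"
    and cut: "\<And>Q. Q \<subset> V \<Longrightarrow> Q \<noteq> {} \<Longrightarrow> k \<le> card {e \<in> E. \<delta> e \<inter> Q \<noteq> {} \<and> \<not> \<delta> e \<subseteq> Q}"
  shows "m * card (p ` V) \<le> card (crossing E p) + m"
proof (cases "card (p ` V) \<ge> 2")
  case True
  have "k * card (p ` V) \<le> 2 * card (crossing E p)"
    using boundary_split[OF cut, of "{}" p] True ind_V[OF order_refl] ind_empty[OF order_refl]
    by simp
  moreover have "2 * m * card (p ` V) \<le> k * card (p ` V)"
    using assms(1) by (rule mult_le_mono1)
  ultimately show ?thesis by linarith
next
  case False
  then have "m * card (p ` V) \<le> m * 1" by (intro mult_le_mono2) simp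
  then show ?thesis by linarith
qed

end

subsection \<open>Factors of a multigraph\<close>

lemma ceiling_shift:
  fixes x y :: real
  assumes "int d \<le> \<lceil>x\<rceil>" "x \<le> y + real n"
  shows "int d \<le> \<lceil>y\<rceil> + int n"
proof -
  have "\<lceil>x\<rceil> \<le> \<lceil>y + real n\<rceil>" using assms(2) by (rule ceiling_mono)
  then show ?thesis using assms(1) by linarith
qed

context
  fixes G :: "('v, 'e) mgraph"
  assumes G: "multigraph G"
begin

interpretation multi "verts G" "edges G" "ends G"
  using G unfolding multigraph_def by unfold_locales simp_all

lemma adjacency_adj:
  assumes "\<And>e. e \<in> edges H \<Longrightarrow> ends H e = ends G e"
  shows "adjacency H = adj (edges H)"
  using assms unfolding adjacency_def adj_def by auto

lemma tree_connected_crossing: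
  assumes "tree_connected k G"
  shows "k * card (q ` verts G) \<le> card (crossing (edges G) q) + k"
proof -
  obtain T :: "nat \<Rightarrow> ('v, 'e) mgraph" where T: "\<And>i. i < k \<Longrightarrow> spanning_tree (T i) G"
      "\<And>i j. i < k \<Longrightarrow> j < k \<Longrightarrow> i \<noteq> j \<Longrightarrow> edges (T i) \<inter> edges (T j) = {}"
    using assms unfolding tree_connected_def by metis
  have sub: "edges (T i) \<subseteq> edges G" and con: "connected_graph (T i)"
    and V: "verts (T i) = verts G" and ends: "\<And>e. e \<in> edges (T i) \<Longrightarrow> ends (T i) e = ends G e"
    if "i < k" for i
    using T(1)[OF that] unfolding spanning_tree_def is_factor_def subgraph_def is_tree_def by auto
  have "(x, y) \<in> conn (edges (T i))" if "i < k" "x \<in> verts G" "y \<in> verts G" for i x y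
    using con[OF that(1)] that(2,3) V[OF that(1)] adjacency_adj[OF ends[OF that(1)]]
    unfolding connected_graph_def conn_def by simp
  then show ?thesis by (intro trees_crossing[of k "\<lambda>i. edges (T i)"] sub T(2))
qed

lemma edge_connected_boundary:
  assumes "edge_connected k G" "Q \<subset> verts G" "Q \<noteq> {}"
  shows "k \<le> card {e \<in> edges G. ends G e \<inter> Q \<noteq> {} \<and> \<not> ends G e \<subseteq> Q}"
proof (rule ccontr)
  let ?F = "{e \<in> edges G. ends G e \<inter> Q \<noteq> {} \<and> \<not> ends G e \<subseteq> Q}"
  let ?H = "delete_edges G ?F"
  assume "\<not> ?thesis"
  then have con: "connected_graph ?H"
    using assms(1) unfolding edge_connected_def by (simp add: not_le)
  obtain x y where xy: "x \<in> Q" "x \<in> verts G" "y \<in> verts G" "y \<notin> Q" using assms(2,3) by blast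
  have "adjacency ?H = adj (edges G - ?F)"
    using adjacency_adj[of ?H] by (simp add: delete_edges_def)
  then have "(x, y) \<in> conn (edges G - ?F)"
    using con xy(2,3) unfolding connected_graph_def conn_def by (simp add: delete_edges_def)
  then have "y \<in> Q" using xy(1) by (rule conn_closed) blast
  then show False using xy(4) by simp
qed

text \<open>Without its first edge the cycle still joins the ends of that edge, which is then no
  bridge. This includes cycles of length two, because their edges are distinct.\<close>

lemma forest_no_cycle:
  assumes "forest F"
  shows "\<not> is_cycle (G\<lparr>edges := F\<rparr>) vs es"
proof
  assume "is_cycle (G\<lparr>edges := F\<rparr>) vs es"
  then have len: "length vs \<ge> 2" "length es = length vs" and dist: "distinct es"
    and sub: "set es \<subseteq> F"
    and ends: "\<And>i. i < length vs \<Longrightarrow> ends G (es ! i) = {vs ! i, vs ! (Suc i mod length vs)}"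
    unfolding is_cycle_def by auto
  let ?e = "es ! 0" and ?n = "length vs"
  have mem: "es ! j \<in> F" if "j < ?n" for j using sub len(2) that by (metis nth_mem subsetD)
  have "1 < ?n" "vs \<noteq> []" using len(1) by auto
  then have e: "?e \<in> F" "ends G ?e = {vs ! 0, vs ! 1}"
    using mem[of 0] ends[of 0] by simp_all
  have other: "es ! j \<in> F - {?e}" if "1 \<le> j" "j < ?n" for j
  proof -
    have "es ! j \<noteq> ?e"
      using that \<open>1 < ?n\<close> dist len(2) nth_eq_iff_index_eq[OF dist, of j 0] by linarith
    then show ?thesis using mem[OF that(2)] by simp
  qed
  have path: "(vs ! 1, vs ! j) \<in> conn (F - {?e})" if "1 \<le> j" "j < ?n" for j
    using that
  proof (induction j rule: dec_induct)
    case (step j)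
    then have "(vs ! j, vs ! Suc j) \<in> conn (F - {?e})"
      using conn_edge[OF other[of j]] ends[of j] by simp
    then show ?case using step conn_trans by simp
  qed simp
  have last: "1 \<le> ?n - 1" "?n - 1 < ?n" "Suc (?n - 1) = ?n" using len(1) by linarith+
  then have "ends G (es ! (?n - 1)) = {vs ! (?n - 1), vs ! 0}"
    using ends[of "?n - 1"] by simp
  then have "(vs ! (?n - 1), vs ! 0) \<in> conn (F - {?e})"
    using conn_edge[OF other[OF last(1,2)]] by simp
  then have "(vs ! 0, vs ! 1) \<in> conn (F - {?e})"
    using path[OF last(1,2)] conn_trans conn_sym by meson
  then show False using assms e unfolding forest_def by blast
qed

lemma factor_of_edges: "F \<subseteq> edges G \<Longrightarrow> is_factor (G\<lparr>edges := F\<rparr>) G"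
  using G finite_edges[of F] unfolding is_factor_def subgraph_def multigraph_def by auto

lemma tree_connected_basis:
  assumes "basis m F"
  shows "tree_connected m (G\<lparr>edges := F\<rparr>)"
proof -
  obtain T where T: "packing m F T"
      "\<And>i x y. i < m \<Longrightarrow> x \<in> verts G \<Longrightarrow> y \<in> verts G \<Longrightarrow> (x, y) \<in> conn (T i)"
    using basis_spanning_trees[OF assms] by blast
  have "spanning_tree (G\<lparr>edges := T i\<rparr>) (G\<lparr>edges := F\<rparr>)" if i: "i < m" for i
  proof -
    have TF: "T i \<subseteq> F" and forest: "forest (T i)" using packingD[OF T(1) i] by blast+
    have FE: "F \<subseteq> edges G" using basis_subset[OF assms] .
    then have mg: "multigraph (G\<lparr>edges := T i\<rparr>)"
      using factor_of_edges[of "T i"] TF unfolding is_factor_def subgraph_def by blast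
    have "adjacency (G\<lparr>edges := T i\<rparr>) = adj (T i)"
      using adjacency_adj[of "G\<lparr>edges := T i\<rparr>"] by simp
    then have "connected_graph (G\<lparr>edges := T i\<rparr>)"
      using T(2)[OF i] unfolding connected_graph_def conn_def by simp
    then show ?thesis
      using mg TF forest_no_cycle[OF forest]
      unfolding spanning_tree_def is_tree_def is_factor_def subgraph_def by simp
  qed
  then show ?thesis
    unfolding tree_connected_def using packing_disjoint[OF T(1)]
    by (intro exI[of _ "\<lambda>i. G\<lparr>edges := T i\<rparr>"]) simp
qed

lemma independent_ends:
  assumes "independent_set G X" "e \<in> edges G"
  shows "\<not> ends G e \<subseteq> X"
proof
  assume sub: "ends G e \<subseteq> X"
  obtain x y where "ends G e = {x, y}" using assms(2) by (rule ends_obtain)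
  then show False
    using sub assms unfolding independent_set_def adjacency_def by blast
qed

lemma small_degree_factor:
  assumes m: "m \<ge> 1" and X: "X \<subseteq> verts G" and u: "u \<in> X"
    and M: "is_factor M G" "max_degree M \<le> m"
    and k: "(edge_connected k G \<and> k \<ge> 2 * m) \<or> (tree_connected k G \<and> k \<ge> m)"
  shows "\<exists>H. is_factor H G \<and> tree_connected m H \<and> subgraph M H \<and>
    (\<forall>v\<in>X. degree_bounds m k G X H v) \<and>
    int (degree H u) \<le> \<lfloor>real m / real k * real (degree G u)\<rfloor>"
proof -
  let ?T = "tree_connected k G \<and> k \<ge> m" and ?I = "independent_set G X"
    and ?r = "real m / real k"
  \<comment> \<open>With \<open>d\<close> the degree in \<open>G\<close>, the four bounds round up
    \<open>?r * d + c\<close> for the constants \<open>2 * m * (1 - ?r)\<close>,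
    \<open>m * (1 - ?r)\<close>, \<open>m\<close> and \<open>0\<close>. The smallest applicable one
    is chosen, so that a single \<open>H\<close> satisfies all of them.\<close>
  define c where "c = (if ?T then if ?I then 0 else real m * (1 - ?r)
    else if ?I then real m else 2 * real m * (1 - ?r))"
  have km: "k \<ge> m" using k by auto
  have r: "0 \<le> ?r" "?r \<le> 1" using m km by simp_all
  have half: "2 * ?r \<le> 1" if "k \<ge> 2 * m" using that m by (simp add: field_simps)
  have c0: "0 \<le> c" using r unfolding c_def by simp
  have MG: "verts M = verts G" "edges M \<subseteq> edges G" "\<And>e. e \<in> edges M \<Longrightarrow> ends M e = ends G e"
    and mM: "multigraph M"
    using M(1) unfolding is_factor_def subgraph_def by auto
  have degM: "deg (edges M) v \<le> m" if v: "v \<in> verts G" for v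
  proof -
    have "{e \<in> edges M. v \<in> ends M e} = {e \<in> edges M. v \<in> ends G e}" using MG(3) by auto
    then have "deg (edges M) v = degree M v" unfolding deg_def degree_def by simp
    also have "\<dots> \<le> max_degree M"
      unfolding max_degree_def using v MG(1) finV by (intro Max_ge) simp_all
    finally show ?thesis using M(2) by simp
  qed
  have indep: "\<not> ends G e \<subseteq> X" if "?I" "e \<in> edges G" for e using independent_ends that .
  obtain F0 where F0: "basis m F0" "edges M \<subseteq> F0"
  proof (rule sparse_extend[OF sparse_if_deg[OF MG(2) degM]])
    fix p :: "'v \<Rightarrow> 'v set"
    show "m * card (p ` verts G) \<le> card (crossing (edges G) p) + m"
    proof (cases ?T)
      case True
      then show ?thesis using tree_cut_condition[OF km tree_connected_crossing] by blast
    next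
      case False
      then have "edge_connected k G" "k \<ge> 2 * m" using k by auto
      then show ?thesis using edge_cut_condition edge_connected_boundary by blast
    qed
  qed
  have cond: "m * (card S + card (p ` (verts G - S))) + card (ind F S)
      \<le> ?r * (\<Sum>v\<in>S. deg (edges G) v) + c * (real (card S) - 1)
        + card (crossing (ind (edges G) (verts G - S)) p) + m"
    if S: "S \<subseteq> X" "S \<noteq> {}" "basis m F" for S F and p :: "'v \<Rightarrow> 'v set"
  proof (cases ?T)
    case True
    then have "c = real m * (1 - ?r) \<or> c = 0 \<and> (\<forall>e\<in>edges G. \<not> ends G e \<subseteq> X)"
      using indep unfolding c_def by (simp only: True if_True) auto
    then show ?thesis
      using tree_case[OF m km tree_connected_crossing S(1) X S(2,3)] True by blast
  next
    case False
    then have ek: "edge_connected k G" "2 * m \<le> k" using k by auto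
    have c: "c = 2 * real m * (1 - ?r) \<or> c = real m \<and> (\<forall>e\<in>edges G. \<not> ends G e \<subseteq> X)"
      using indep unfolding c_def by (simp only: False if_False) auto
    show ?thesis
      by (rule edge_case[OF m ek(2) _ S(1) X S(2,3) c]) (rule edge_connected_boundary[OF ek(1)])
  qed
  obtain F where F: "basis m F" "edges M \<subseteq> F"
      "\<And>v. v \<in> X \<Longrightarrow> int (deg F v) \<le> \<lceil>?r * deg (edges G) v + c\<rceil>"
      "int (deg F u) \<le> \<lfloor>?r * deg (edges G) u\<rfloor>"
    using rounded_basis[OF MG(2) degM X u F0 c0 cond] by blast
  let ?H = "G\<lparr>edges := F\<rparr>"
  have degs: "degree ?H v = deg F v" "degree G v = deg (edges G) v" for v
    unfolding degree_def deg_def by simp_all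
  have "degree_bounds m k G X ?H v" if v: "v \<in> X" for v
  proof -
    note shift = ceiling_shift[OF F(3)[OF v]]
    let ?d = "real (deg (edges G) v)"
    have "int (deg F v) \<le> \<lceil>?r * (?d - 2 * real m)\<rceil> + int (2 * m)" if "k \<ge> 2 * m"
    proof (rule shift)
      \<comment> \<open>From \<open>k \<ge> 2 * m\<close> follows
        \<open>m \<le> 2 * m * (1 - ?r)\<close>, which covers the choice
        \<open>c = m\<close>.\<close>
      have "c \<le> 2 * real m * (1 - ?r)"
      proof -
        have "real m * 1 \<le> real m * (2 * (1 - ?r))"
          using half[OF that] by (intro mult_left_mono) simp_all
        also have "\<dots> = 2 * real m * (1 - ?r)" by simp
        finally have "real m \<le> 2 * real m * (1 - ?r)" by simp
        moreover have "0 \<le> real m * (1 - ?r)" using r by (intro mult_nonneg_nonneg) simp_all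
        ultimately show ?thesis unfolding c_def by auto
      qed
      then show "?r * ?d + c \<le> ?r * (?d - 2 * real m) + real (2 * m)"
        by (simp add: algebra_simps)
    qed
    moreover have "int (deg F v) \<le> \<lceil>?r * (?d - real m)\<rceil> + int m" if "?T"
    proof (rule shift)
      have "c \<le> real m * (1 - ?r)" using that r unfolding c_def by simp
      then show "?r * ?d + c \<le> ?r * (?d - real m) + real m" by (simp add: algebra_simps)
    qed
    moreover have "int (deg F v) \<le> \<lceil>?r * ?d\<rceil> + int m" if "?I"
      using that by (intro shift) (simp add: c_def)
    moreover have "int (deg F v) \<le> \<lceil>?r * ?d\<rceil> + int 0" if "?T" "?I"
      using that by (intro shift) (simp add: c_def)
    ultimately show ?thesis unfolding degree_bounds_def degs by simp
  qed
  moreover have "subgraph M ?H" using mM MG F(2) unfolding subgraph_def by simp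
  moreover have "is_factor ?H G" using factor_of_edges basis_subset[OF F(1)] .
  moreover have "tree_connected m ?H" by (rule tree_connected_basis[OF F(1)])
  ultimately show ?thesis using F(4) unfolding degs[symmetric] by blast
qed

end

theorem theorem5p2:
  fixes G M :: "('v, 'e) mgraph" and X :: "'v set" and m k :: nat
  assumes "m \<ge> 1" and "k \<ge> 1"
    and "multigraph G"
    and "X \<subseteq> verts G"
    and "is_factor M G" and "max_degree M \<le> m"
    and "(edge_connected k G \<and> k \<ge> 2 * m) \<or> (tree_connected k G \<and> k \<ge> m)"
  shows "(\<exists>H. is_factor H G \<and> tree_connected m H \<and> subgraph M H \<and>
              (\<forall>v\<in>X. degree_bounds m k G X H v)) \<and>
         (\<forall>u\<in>X. \<exists>H. is_factor H G \<and> tree_connected m H \<and> subgraph M H \<and>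
              (\<forall>v\<in>X. degree_bounds m k G X H v) \<and>
              int (degree H u) \<le> \<lfloor>real m / real k * real (degree G u)\<rfloor>)"
proof -
  note factor = small_degree_factor[OF assms(3,1) _ _ assms(5-7)]
  have bounded: "\<exists>H. is_factor H G \<and> tree_connected m H \<and> subgraph M H \<and>
      (\<forall>v\<in>X. degree_bounds m k G X H v) \<and>
      int (degree H u) \<le> \<lfloor>real m / real k * real (degree G u)\<rfloor>" if "u \<in> X" for u
    using factor[OF assms(4) that] .
  moreover have "\<exists>H. is_factor H G \<and> tree_connected m H \<and> subgraph M H \<and>
      (\<forall>v\<in>X. degree_bounds m k G X H v)"
  proof (cases "X = {}")
    case True
    \<comment> \<open>There is no \<open>u\<close> in \<open>X\<close> to choose, so the lemma is
      applied to the single vertex \<open>w\<close>; the degree bounds over the empty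
      \<open>X\<close> hold vacuously.\<close>
    obtain w where "w \<in> verts G" using assms(3) unfolding multigraph_def by blast
    then show ?thesis using factor[of "{w}" w] True by auto
  next
    case False
    then show ?thesis using bounded by blast
  qed
  ultimately show ?thesis by blast
qed

end
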